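(* Let $\delta_i\to0$, $i=0,1,2,\dots$, be a decreasing sequence of positive numbers and let $M_j$ be a sequence of open Riemannian manifolds such that for all $i$ $$(\bar M_j^{\delta_i},d_{M_j})\to(Y^{\delta_i},d_{Y^{\delta_i}})\quad\text{as } j\to\infty$$ in the Gromov-Hausdorff sense, with $Y^{\delta_i}$ compact, where possibly some of these sequences and their limits are eventually empty sets. Then there exist subsequential limit isometric embeddings $$\varphi_{\delta_{i+1},\delta_i}:Y^{\delta_i}\to Y^{\delta_{i+1}},$$ which are just the identity when $\delta_i=\delta_{i+1}$. Moreover, if $\delta\in(0,\delta_0]$ and $i$ is such that $\delta_{i+1}\le\delta\le\delta_i$, there exists a compact metric space $Y^\delta$ with $Y^{\delta_i}\subset Y^\delta\subset Y^{\delta_{i+1}}$ (where $Y^{\delta_i}$ is identified with $\varphi_{\delta_{i+1},\delta_i}(Y^{\delta_i})\subset Y^{\delta_{i+1}}$), with the restricted metric $d_{Y^\delta}=d_{Y^{\delta_{i+1}}}$, and a converging subsequence $$(\bar M_{j_k}^\delta,d_{M_{j_k}})\to(Y^\delta,d_{Y^\delta})$$ in the Gromov-Hausdorff sense; and when $\delta\in(\delta_{i+1},\delta_i)$, for any such $Y^\delta$ the map $\varphi_{\delta,\delta_i}:Y^{\delta_i}\to Y^\delta$ given by $\varphi_{\delta_{i+1},\delta_i}$ with codomain restricted to $Y^\delta$, and the inclusion map $\varphi_{\delta_{i+1},\delta}:Y^\delta\to Y^{\delta_{i+1}}$, are isometric embeddings.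
   Context: For an open (not necessarily complete) Riemannian manifold $(M,g)$, $d_M$ is the length metric, $\bar M$ the metric completion, $\partial M:=\bar M\setminus M$ (no regularity assumed), $M^\delta=\{x\in M:d_M(x,\partial M)>\delta\}$ ($M^\delta=M$ if $\partial M=\emptyset$), and $\bar M^\delta$ is the metric completion of $M^\delta$ with the restricted metric $d_M$. Isometric embeddings are distance-preserving maps. The Gromov-Hausdorff limit of empty spaces is the empty space. An isometric embedding $\varphi_{\delta_{i+1},\delta_i}:Y^{\delta_i}\to Y^{\delta_{i+1}}$ is a "subsequential limit" isometric embedding if it arises as follows: there are a compact metric space $Z_i$, isometric embeddings $\varphi_j:\bar M_j^{\delta_{i+1}}\to Z_i$ and $\varphi_\infty:Y^{\delta_{i+1}}\to Z_i$ with $\varphi_j(\bar M_j^{\delta_{i+1}})\to\varphi_\infty(Y^{\delta_{i+1}})$ in the Hausdorff sense in $Z_i$, and a subsequence $\{j_k\}$ such that $\varphi_{j_k}(\bar M_{j_k}^{\delta_i})$ converges in the Hausdorff sense to a compact set $X^{\delta_i}$ with $\varphi_{\delta_{i+1},\delta_i}(Y^{\delta_i})=\varphi_\infty^{-1}(X^{\delta_i})$. *)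

theory Defs
  imports "HOL-Analysis.Analysis"
begin

section \<open>Riemannian manifolds and their length metric\<close>

text \<open>Coordinates live in \<^term>\<open>Euclidean_space n\<close>, the subspace of \<^typ>\<open>nat \<Rightarrow> real\<close> of
  vectors vanishing from index n on, so that the dimension is an ordinary natural number and
  may vary along a sequence of manifolds.\<close>

definition partial_deriv :: "nat \<Rightarrow> ((nat \<Rightarrow> real) \<Rightarrow> real) \<Rightarrow> (nat \<Rightarrow> real) \<Rightarrow> real" where
  "partial_deriv i f x = deriv (\<lambda>t. f (x(i := t))) (x i)"

text \<open>Class C^k on a subset S, always used for S open in \<^term>\<open>Euclidean_space n\<close>.\<close>

primrec Ck_on :: "nat \<Rightarrow> nat \<Rightarrow> (nat \<Rightarrow> real) set \<Rightarrow> ((nat \<Rightarrow> real) \<Rightarrow> real) \<Rightarrow> bool" where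
  "Ck_on 0 n S f \<longleftrightarrow> continuous_map (subtopology (Euclidean_space n) S) euclideanreal f"
| "Ck_on (Suc k) n S f \<longleftrightarrow>
     continuous_map (subtopology (Euclidean_space n) S) euclideanreal f \<and>
     (\<forall>i<n. (\<forall>x\<in>S. (\<lambda>t. f (x(i := t))) field_differentiable at (x i)) \<and>
            Ck_on k n S (partial_deriv i f))"

definition smooth_on :: "nat \<Rightarrow> (nat \<Rightarrow> real) set \<Rightarrow> ((nat \<Rightarrow> real) \<Rightarrow> real) \<Rightarrow> bool" where
  "smooth_on n S f \<longleftrightarrow> (\<forall>k. Ck_on k n S f)"

text \<open>A chart carries the components \<open>gram c p i j\<close> of the Riemannian metric at the point p
  in its coordinate frame.\<close>

record 'a chart =
  cdom :: "'a set"
  coords :: "'a \<Rightarrow> nat \<Rightarrow> real"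
  gram :: "'a \<Rightarrow> nat \<Rightarrow> nat \<Rightarrow> real"

record 'a riemannian =
  rtop :: "'a topology"
  rdim :: nat
  atlas :: "'a chart set"

definition chart_inv :: "'a chart \<Rightarrow> (nat \<Rightarrow> real) \<Rightarrow> 'a" where
  "chart_inv c = inv_into (cdom c) (coords c)"

definition is_chart :: "'a topology \<Rightarrow> nat \<Rightarrow> 'a chart \<Rightarrow> bool" where
  "is_chart X n c \<longleftrightarrow>
     openin X (cdom c) \<and> openin (Euclidean_space n) (coords c ` cdom c) \<and>
     homeomorphic_map (subtopology X (cdom c))
       (subtopology (Euclidean_space n) (coords c ` cdom c)) (coords c)"

definition transition :: "'a chart \<Rightarrow> 'a chart \<Rightarrow> nat \<Rightarrow> (nat \<Rightarrow> real) \<Rightarrow> real" where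
  "transition c c' k x = coords c' (chart_inv c x) k"

definition smooth_atlas :: "'a topology \<Rightarrow> nat \<Rightarrow> 'a chart set \<Rightarrow> bool" where
  "smooth_atlas X n \<A> \<longleftrightarrow>
     (\<forall>c\<in>\<A>. is_chart X n c) \<and> (\<Union>c\<in>\<A>. cdom c) = topspace X \<and>
     (\<forall>c\<in>\<A>. \<forall>c'\<in>\<A>. \<forall>k<n. smooth_on n (coords c ` (cdom c \<inter> cdom c')) (transition c c' k))"

text \<open>The last conjunct is the transformation law of a covariant 2-tensor.\<close>

definition riemannian_tensor :: "nat \<Rightarrow> 'a chart set \<Rightarrow> bool" where
  "riemannian_tensor n \<A> \<longleftrightarrow>
     (\<forall>c\<in>\<A>.
        (\<forall>i<n. \<forall>j<n. smooth_on n (coords c ` cdom c) (\<lambda>x. gram c (chart_inv c x) i j)) \<and>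
        (\<forall>p\<in>cdom c. \<forall>i<n. \<forall>j<n. gram c p i j = gram c p j i) \<and>
        (\<forall>p\<in>cdom c. \<forall>v. (\<exists>i<n. v i \<noteq> 0) \<longrightarrow> 0 < (\<Sum>i<n. \<Sum>j<n. gram c p i j * v i * v j))) \<and>
     (\<forall>c\<in>\<A>. \<forall>c'\<in>\<A>. \<forall>p\<in>cdom c \<inter> cdom c'. \<forall>i<n. \<forall>j<n.
        gram c p i j =
          (\<Sum>k<n. \<Sum>l<n. partial_deriv i (transition c c' k) (coords c p) *
                         partial_deriv j (transition c c' l) (coords c p) * gram c' p k l))"

text \<open>Manifolds are connected (so that the length metric is finite) and have no boundary
  points of their own; nothing is assumed about completeness.\<close>

definition open_riemannian_manifold :: "'a riemannian \<Rightarrow> bool" where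
  "open_riemannian_manifold M \<longleftrightarrow>
     Hausdorff_space (rtop M) \<and> second_countable (rtop M) \<and> connected_space (rtop M) \<and>
     smooth_atlas (rtop M) (rdim M) (atlas M) \<and> riemannian_tensor (rdim M) (atlas M)"

text \<open>C^1 on the closed interval [s,t], with one-sided derivatives at the end points.\<close>

definition C1_curve :: "'a riemannian \<Rightarrow> real \<Rightarrow> real \<Rightarrow> (real \<Rightarrow> 'a) \<Rightarrow> bool" where
  "C1_curve M s t \<gamma> \<longleftrightarrow>
     continuous_map (top_of_set {s..t}) (rtop M) \<gamma> \<and>
     (\<forall>c\<in>atlas M. \<forall>k<rdim M. \<exists>v. continuous_on {\<tau>\<in>{s..t}. \<gamma> \<tau> \<in> cdom c} v \<and>
        (\<forall>\<tau>\<in>{s..t}. \<gamma> \<tau> \<in> cdom c \<longrightarrow>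
           ((\<lambda>\<sigma>. coords c (\<gamma> \<sigma>) k) has_real_derivative v \<tau>) (at \<tau> within {s..t})))"

definition piecewise_C1_curve :: "'a riemannian \<Rightarrow> real \<Rightarrow> real \<Rightarrow> (real \<Rightarrow> 'a) \<Rightarrow> bool" where
  "piecewise_C1_curve M a b \<gamma> \<longleftrightarrow>
     (\<exists>N::nat. \<exists>t::nat \<Rightarrow> real. t 0 = a \<and> t N = b \<and>
        (\<forall>m<N. t m < t (Suc m) \<and> C1_curve M (t m) (t (Suc m)) \<gamma>))"

text \<open>The norm of the velocity; by the transformation law it does not depend on the chart.
  At the finitely many break points of a piecewise C^1 curve, where \<^const>\<open>deriv\<close> may be
  meaningless, its value does not affect the length.\<close>

definition speed :: "'a riemannian \<Rightarrow> (real \<Rightarrow> 'a) \<Rightarrow> real \<Rightarrow> real" where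
  "speed M \<gamma> \<tau> =
     (let c = (SOME c. c \<in> atlas M \<and> \<gamma> \<tau> \<in> cdom c);
          v = (\<lambda>k. deriv (\<lambda>\<sigma>. coords c (\<gamma> \<sigma>) k) \<tau>)
      in sqrt (\<Sum>i<rdim M. \<Sum>j<rdim M. gram c (\<gamma> \<tau>) i j * v i * v j))"

definition curve_length :: "'a riemannian \<Rightarrow> real \<Rightarrow> real \<Rightarrow> (real \<Rightarrow> 'a) \<Rightarrow> real" where
  "curve_length M a b \<gamma> = integral {a..b} (speed M \<gamma>)"

text \<open>The value 0 off the manifold is forced by the convention of \<^locale>\<open>Metric_space\<close>
  that distance functions are nonnegative and symmetric on the whole type.\<close>

definition length_dist :: "'a riemannian \<Rightarrow> 'a \<Rightarrow> 'a \<Rightarrow> real" where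
  "length_dist M x y =
     (if x \<in> topspace (rtop M) \<and> y \<in> topspace (rtop M)
      then Inf {curve_length M a b \<gamma> | a b \<gamma>.
                  a \<le> b \<and> piecewise_C1_curve M a b \<gamma> \<and> \<gamma> a = x \<and> \<gamma> b = y}
      else 0)"

definition length_metric :: "'a riemannian \<Rightarrow> 'a metric" where
  "length_metric M = metric (topspace (rtop M), length_dist M)"

section \<open>Metric completion, boundary and inner regions\<close>

text \<open>Points of the completion are classes of Cauchy sequences at mutual distance tending to 0.\<close>

definition Cauchy_seqs :: "'a metric \<Rightarrow> (nat \<Rightarrow> 'a) set" where
  "Cauchy_seqs m = {\<sigma>. Metric_space.MCauchy (mspace m) (mdist m) \<sigma>}"

definition Cauchy_equiv :: "'a metric \<Rightarrow> ((nat \<Rightarrow> 'a) \<times> (nat \<Rightarrow> 'a)) set" where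
  "Cauchy_equiv m = {(\<sigma>, \<tau>). \<sigma> \<in> Cauchy_seqs m \<and> \<tau> \<in> Cauchy_seqs m \<and>
                             (\<lambda>n. mdist m (\<sigma> n) (\<tau> n)) \<longlonglongrightarrow> 0}"

definition completion_points :: "'a metric \<Rightarrow> (nat \<Rightarrow> 'a) set set" where
  "completion_points m = Cauchy_seqs m // Cauchy_equiv m"

definition completion_dist :: "'a metric \<Rightarrow> (nat \<Rightarrow> 'a) set \<Rightarrow> (nat \<Rightarrow> 'a) set \<Rightarrow> real" where
  "completion_dist m C D =
     (if C \<in> completion_points m \<and> D \<in> completion_points m
      then lim (\<lambda>n. mdist m ((SOME \<sigma>. \<sigma> \<in> C) n) ((SOME \<tau>. \<tau> \<in> D) n))
      else 0)"

definition completion :: "'a metric \<Rightarrow> (nat \<Rightarrow> 'a) set metric" where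
  "completion m = metric (completion_points m, completion_dist m)"

lemma Cauchy_seqs_iff:
  "\<sigma> \<in> Cauchy_seqs m \<longleftrightarrow> range \<sigma> \<subseteq> mspace m \<and>
     (\<forall>\<epsilon>>0. \<exists>N. \<forall>n n'. N \<le> n \<longrightarrow> N \<le> n' \<longrightarrow> mdist m (\<sigma> n) (\<sigma> n') < \<epsilon>)"
  by (simp add: Cauchy_seqs_def Metric_space.MCauchy_def)

lemma Cauchy_seqs_in: "\<sigma> \<in> Cauchy_seqs m \<Longrightarrow> \<sigma> n \<in> mspace m"
  by (auto simp: Cauchy_seqs_iff)

lemma mdist_quadrilateral:
  assumes "a \<in> mspace m" "b \<in> mspace m" "c \<in> mspace m" "d \<in> mspace m"
  shows "\<bar>mdist m a b - mdist m c d\<bar> \<le> mdist m a c + mdist m b d"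
  using mdist_triangle[of a m c b] mdist_triangle[of c m d b] mdist_triangle[of c m a d]
    mdist_triangle[of a m b d] mdist_commute[of m c a] mdist_commute[of m d b] assms
  by linarith

lemma Cauchy_seqs_convergent:
  assumes "\<sigma> \<in> Cauchy_seqs m" "\<tau> \<in> Cauchy_seqs m"
  shows "convergent (\<lambda>n. mdist m (\<sigma> n) (\<tau> n))"
proof -
  have "Cauchy (\<lambda>n. mdist m (\<sigma> n) (\<tau> n))"
  proof (rule metric_CauchyI)
    fix e :: real assume "0 < e"
    then have e2: "0 < e/2" by simp
    obtain N1 where N1: "\<forall>n n'. N1 \<le> n \<longrightarrow> N1 \<le> n' \<longrightarrow> mdist m (\<sigma> n) (\<sigma> n') < e/2"
      using assms(1) e2 unfolding Cauchy_seqs_iff by blast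
    obtain N2 where N2: "\<forall>n n'. N2 \<le> n \<longrightarrow> N2 \<le> n' \<longrightarrow> mdist m (\<tau> n) (\<tau> n') < e/2"
      using assms(2) e2 unfolding Cauchy_seqs_iff by blast
    have "dist (mdist m (\<sigma> k) (\<tau> k)) (mdist m (\<sigma> n) (\<tau> n)) < e"
      if "max N1 N2 \<le> k" "max N1 N2 \<le> n" for k n
    proof -
      have "\<bar>mdist m (\<sigma> k) (\<tau> k) - mdist m (\<sigma> n) (\<tau> n)\<bar>
              \<le> mdist m (\<sigma> k) (\<sigma> n) + mdist m (\<tau> k) (\<tau> n)"
        using assms by (intro mdist_quadrilateral Cauchy_seqs_in)
      moreover have "mdist m (\<sigma> k) (\<sigma> n) < e/2" "mdist m (\<tau> k) (\<tau> n) < e/2"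
        using N1 N2 that by auto
      ultimately show ?thesis by (simp add: dist_real_def)
    qed
    then show "\<exists>N. \<forall>k\<ge>N. \<forall>n\<ge>N. dist (mdist m (\<sigma> k) (\<tau> k)) (mdist m (\<sigma> n) (\<tau> n)) < e"
      by blast
  qed
  then show ?thesis by (simp add: Cauchy_convergent_iff)
qed

lemma equiv_Cauchy_equiv: "equiv (Cauchy_seqs m) (Cauchy_equiv m)"
proof (rule equivI)
  show "Cauchy_equiv m \<subseteq> Cauchy_seqs m \<times> Cauchy_seqs m"
    by (auto simp: Cauchy_equiv_def)
  have "mdist m (\<sigma> n) (\<sigma> n) = 0" if "\<sigma> \<in> Cauchy_seqs m" for \<sigma> n
    using Cauchy_seqs_in[OF that] by simp
  then show "refl_on (Cauchy_seqs m) (Cauchy_equiv m)"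
    by (auto simp: refl_on_def Cauchy_equiv_def)
  show "sym (Cauchy_equiv m)"
    by (auto simp: sym_def Cauchy_equiv_def mdist_commute)
  show "trans (Cauchy_equiv m)"
  proof (rule transI)
    fix a b c assume ab: "(a, b) \<in> Cauchy_equiv m" and bc: "(b, c) \<in> Cauchy_equiv m"
    then have *: "a \<in> Cauchy_seqs m" "b \<in> Cauchy_seqs m" "c \<in> Cauchy_seqs m"
      by (auto simp: Cauchy_equiv_def)
    have lim: "(\<lambda>n. mdist m (a n) (b n) + mdist m (b n) (c n)) \<longlonglongrightarrow> 0"
      using ab bc tendsto_add[of "\<lambda>n. mdist m (a n) (b n)" 0 sequentially
          "\<lambda>n. mdist m (b n) (c n)" 0] by (simp add: Cauchy_equiv_def)
    have "norm (mdist m (a n) (c n)) \<le> mdist m (a n) (b n) + mdist m (b n) (c n)" for n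
      by (simp add: mdist_triangle *[THEN Cauchy_seqs_in])
    then have "(\<lambda>n. mdist m (a n) (c n)) \<longlonglongrightarrow> 0"
      by (intro Lim_null_comparison[OF _ lim] always_eventually allI)
    with * show "(a, c) \<in> Cauchy_equiv m" by (simp add: Cauchy_equiv_def)
  qed
qed

lemma completion_point_rep:
  assumes "C \<in> completion_points m" "\<sigma> \<in> C"
  shows "\<sigma> \<in> Cauchy_seqs m" "C = Cauchy_equiv m `` {\<sigma>}"
proof -
  obtain \<rho> where \<rho>: "\<rho> \<in> Cauchy_seqs m" "C = Cauchy_equiv m `` {\<rho>}"
    using assms(1) unfolding completion_points_def by (auto elim: quotientE)
  then have "(\<rho>, \<sigma>) \<in> Cauchy_equiv m" using assms(2) by simp
  then show "\<sigma> \<in> Cauchy_seqs m" "C = Cauchy_equiv m `` {\<sigma>}"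
    using \<rho>(2) equiv_class_eq[OF equiv_Cauchy_equiv] unfolding Cauchy_equiv_def by blast+
qed

lemma completion_point_SOME: "C \<in> completion_points m \<Longrightarrow> (SOME \<sigma>. \<sigma> \<in> C) \<in> C"
  using equiv_Cauchy_equiv[of m] in_quotient_imp_non_empty
  unfolding completion_points_def some_in_eq by blast

lemma completion_dist_tendsto:
  assumes "C \<in> completion_points m" "D \<in> completion_points m" "\<sigma> \<in> C" "\<tau> \<in> D"
  shows "(\<lambda>n. mdist m (\<sigma> n) (\<tau> n)) \<longlonglongrightarrow> completion_dist m C D"
proof -
  define s where "s = (SOME \<sigma>. \<sigma> \<in> C)"
  define t where "t = (SOME \<tau>. \<tau> \<in> D)"
  have st: "s \<in> C" "t \<in> D"
    using assms completion_point_SOME by (auto simp: s_def t_def)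
  note C = completion_point_rep[OF assms(1)] and D = completion_point_rep[OF assms(2)]
  have mem: "s n \<in> mspace m" "t n \<in> mspace m" "\<sigma> n \<in> mspace m" "\<tau> n \<in> mspace m" for n
    using C(1)[OF st(1)] D(1)[OF st(2)] C(1)[OF assms(3)] D(1)[OF assms(4)]
    by (auto intro: Cauchy_seqs_in)
  have "(\<lambda>n. mdist m (s n) (t n)) \<longlonglongrightarrow> lim (\<lambda>n. mdist m (s n) (t n))"
    using C(1)[OF st(1)] D(1)[OF st(2)] Cauchy_seqs_convergent convergent_LIMSEQ_iff by blast
  then have lim: "(\<lambda>n. mdist m (s n) (t n)) \<longlonglongrightarrow> completion_dist m C D"
    using assms by (simp add: completion_dist_def s_def t_def)
  have "(\<lambda>n. mdist m (\<sigma> n) (s n)) \<longlonglongrightarrow> 0" "(\<lambda>n. mdist m (\<tau> n) (t n)) \<longlonglongrightarrow> 0"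
    using st C(2)[OF assms(3)] D(2)[OF assms(4)] unfolding Cauchy_equiv_def by blast+
  from tendsto_add[OF this]
  have lim0: "(\<lambda>n. mdist m (\<sigma> n) (s n) + mdist m (\<tau> n) (t n)) \<longlonglongrightarrow> 0" by simp
  have "norm (mdist m (\<sigma> n) (\<tau> n) - mdist m (s n) (t n))
          \<le> mdist m (\<sigma> n) (s n) + mdist m (\<tau> n) (t n)" for n
    using mdist_quadrilateral[OF mem(3,4,1,2)] by simp
  then have "(\<lambda>n. mdist m (\<sigma> n) (\<tau> n) - mdist m (s n) (t n)) \<longlonglongrightarrow> 0"
    by (intro Lim_null_comparison[OF _ lim0] always_eventually allI)
  from tendsto_add[OF this lim] show ?thesis by simp
qed

lemma Metric_space_completion: "Metric_space (completion_points m) (completion_dist m)"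
proof
  fix C D E
  show "0 \<le> completion_dist m C D"
  proof (cases "C \<in> completion_points m \<and> D \<in> completion_points m")
    case True
    then have "(\<lambda>n. mdist m ((SOME \<sigma>. \<sigma> \<in> C) n) ((SOME \<tau>. \<tau> \<in> D) n)) \<longlonglongrightarrow> completion_dist m C D"
      by (intro completion_dist_tendsto completion_point_SOME) auto
    then show ?thesis by (rule LIMSEQ_le_const) auto
  qed (auto simp: completion_dist_def)
  show "completion_dist m C D = completion_dist m D C"
    by (auto simp: completion_dist_def mdist_commute)
  assume C: "C \<in> completion_points m" and D: "D \<in> completion_points m"
  define s where "s = (SOME \<sigma>. \<sigma> \<in> C)"
  define t where "t = (SOME \<tau>. \<tau> \<in> D)"
  have s: "s \<in> C" and t: "t \<in> D"
    using C D completion_point_SOME by (auto simp: s_def t_def)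
  note lim = completion_dist_tendsto[OF C D s t]
  note sC = completion_point_rep[OF C s] and tD = completion_point_rep[OF D t]
  show "completion_dist m C D = 0 \<longleftrightarrow> C = D"
  proof
    assume "completion_dist m C D = 0"
    then have "(s, t) \<in> Cauchy_equiv m"
      using lim sC(1) tD(1) by (simp add: Cauchy_equiv_def)
    then show "C = D"
      using equiv_class_eq[OF equiv_Cauchy_equiv] sC(2) tD(2) by metis
  next
    assume "C = D"
    then have "(s, t) \<in> Cauchy_equiv m" using sC(2) t by auto
    then show "completion_dist m C D = 0"
      using lim LIMSEQ_unique by (auto simp: Cauchy_equiv_def)
  qed
  assume E: "E \<in> completion_points m"
  define u where "u = (SOME \<upsilon>. \<upsilon> \<in> E)"
  have u: "u \<in> E" using E completion_point_SOME by (auto simp: u_def)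
  have mem: "s n \<in> mspace m" "t n \<in> mspace m" "u n \<in> mspace m" for n
    using sC(1) tD(1) completion_point_rep(1)[OF E u] by (auto intro: Cauchy_seqs_in)
  show "completion_dist m C E \<le> completion_dist m C D + completion_dist m D E"
    by (rule LIMSEQ_le[OF completion_dist_tendsto[OF C E s u]
              tendsto_add[OF lim completion_dist_tendsto[OF D E t u]]])
       (use mdist_triangle[OF mem] in blast)
qed

lemma mspace_completion [simp]: "mspace (completion m) = completion_points m"
  and mdist_completion [simp]: "mdist (completion m) = completion_dist m"
  using Metric_space_completion[of m]
  by (simp_all add: completion_def Metric_space.mspace_metric Metric_space.mdist_metric)

definition completion_embed :: "'a metric \<Rightarrow> 'a \<Rightarrow> (nat \<Rightarrow> 'a) set" where
  "completion_embed m x = Cauchy_equiv m `` {\<lambda>n. x}"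

definition mboundary :: "'a metric \<Rightarrow> (nat \<Rightarrow> 'a) set set" where
  "mboundary m = mspace (completion m) - completion_embed m ` mspace m"

definition inner_region :: "'a metric \<Rightarrow> real \<Rightarrow> 'a set" where
  "inner_region m \<delta> =
     (if mboundary m = {} then mspace m
      else {x \<in> mspace m.
              \<delta> < (INF p\<in>mboundary m. mdist (completion m) (completion_embed m x) p)})"

definition inner_completion :: "'a metric \<Rightarrow> real \<Rightarrow> (nat \<Rightarrow> 'a) set metric" where
  "inner_completion m \<delta> = completion (submetric m (inner_region m \<delta>))"

text \<open>For \<open>\<delta>' \<le> \<delta>\<close>: the canonical copy of the completed inner region of depth \<open>\<delta>\<close> inside the
  one of depth \<open>\<delta>'\<close>. A class of Cauchy sequences in the smaller region goes to the (unique)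
  class in the larger region that contains it.\<close>

definition inner_completion_in :: "'a metric \<Rightarrow> real \<Rightarrow> real \<Rightarrow> (nat \<Rightarrow> 'a) set set" where
  "inner_completion_in m \<delta>' \<delta> =
     {C \<in> mspace (inner_completion m \<delta>'). \<exists>D \<in> mspace (inner_completion m \<delta>). D \<subseteq> C}"

section \<open>Hausdorff and Gromov-Hausdorff convergence\<close>

definition isometric_embedding :: "'a metric \<Rightarrow> 'b metric \<Rightarrow> ('a \<Rightarrow> 'b) \<Rightarrow> bool" where
  "isometric_embedding X Y f \<longleftrightarrow>
     f \<in> mspace X \<rightarrow> mspace Y \<and>
     (\<forall>x\<in>mspace X. \<forall>y\<in>mspace X. mdist Y (f x) (f y) = mdist X x y)"

text \<open>The distance from the empty set is 0 to itself and infinite to any nonempty set.\<close>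

definition hausdorff_dist :: "'a metric \<Rightarrow> 'a set \<Rightarrow> 'a set \<Rightarrow> ennreal" where
  "hausdorff_dist m A B =
     Inf {ennreal r | r. 0 \<le> r \<and> (\<forall>a\<in>A. \<exists>b\<in>B. mdist m a b \<le> r) \<and>
                                  (\<forall>b\<in>B. \<exists>a\<in>A. mdist m a b \<le> r)}"

definition hausdorff_converges :: "'a metric \<Rightarrow> (nat \<Rightarrow> 'a set) \<Rightarrow> 'a set \<Rightarrow> bool" where
  "hausdorff_converges m A B \<longleftrightarrow> (\<lambda>j. hausdorff_dist m (A j) B) \<longlonglongrightarrow> 0"

text \<open>The ambient space Z may be cut down to the union of the two images, whose points can be
  named in the sum type; so fixing the type of Z loses nothing.\<close>

definition GH_dist :: "'a metric \<Rightarrow> 'b metric \<Rightarrow> ennreal" where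
  "GH_dist X Y =
     Inf {hausdorff_dist Z (f ` mspace X) (g ` mspace Y) | (Z :: ('a + 'b) metric) f g.
            isometric_embedding X Z f \<and> isometric_embedding Y Z g}"

abbreviation compact_metric :: "'a metric \<Rightarrow> bool" where
  "compact_metric X \<equiv> compact_space (mtopology_of X)"

text \<open>Gromov-Hausdorff convergence is a notion for compact metric spaces; only the tail of the
  sequence is required to consist of such spaces. For completed inner regions of Riemannian
  manifolds of positive depth that are Gromov-Hausdorff close to a compact space, compactness
  is automatic, by the Hopf-Rinow theorem.\<close>

definition GH_converges :: "(nat \<Rightarrow> 'a metric) \<Rightarrow> 'b metric \<Rightarrow> bool" where
  "GH_converges X Y \<longleftrightarrow>
     (\<forall>\<^sub>F j in sequentially. compact_metric (X j)) \<and> (\<lambda>j. GH_dist (X j) Y) \<longlonglongrightarrow> 0"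

section \<open>Subsequential limit embeddings\<close>

text \<open>Here \<open>\<delta>' \<le> \<delta>\<close> are consecutive depths, \<open>Y'\<close> and \<open>Y\<close> the limits at these depths.
  The type of Z is no restriction, since a compact metric space with dense sequence \<open>z\<close> is
  determined by the image of the injection sending x to the distances from x to the \<open>z n\<close>.
  The map \<open>\<phi> j\<close> is unconstrained for the finitely many j at which the completed inner region is
  not compact and thus has no isometric embedding into a compact space.\<close>

definition subsequential_limit_embedding ::
  "(nat \<Rightarrow> 'a metric) \<Rightarrow> real \<Rightarrow> real \<Rightarrow> 'b metric \<Rightarrow> 'b metric \<Rightarrow> ('b \<Rightarrow> 'b) \<Rightarrow> bool" where
  "subsequential_limit_embedding m \<delta>' \<delta> Y' Y f \<longleftrightarrow>
     isometric_embedding Y Y' f \<and>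
     (\<exists>(Z :: (nat \<Rightarrow> real) metric) \<phi> \<psi> r K.
        compact_metric Z \<and>
        (\<forall>j. compact_metric (inner_completion (m j) \<delta>') \<longrightarrow>
             isometric_embedding (inner_completion (m j) \<delta>') Z (\<phi> j)) \<and>
        isometric_embedding Y' Z \<psi> \<and>
        hausdorff_converges Z (\<lambda>j. \<phi> j ` mspace (inner_completion (m j) \<delta>')) (\<psi> ` mspace Y') \<and>
        strict_mono r \<and> compactin (mtopology_of Z) K \<and>
        hausdorff_converges Z (\<lambda>k. \<phi> (r k) ` inner_completion_in (m (r k)) \<delta>' \<delta>) K \<and>
        f ` mspace Y = {y \<in> mspace Y'. \<psi> y \<in> K})"

text \<open>S is the underlying set of an admissible limit space at depth \<open>\<delta>\<close> between \<open>f ` mspace Y\<close>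
  and \<open>Y'\<close>, metrized as a subspace of \<open>Y'\<close>.\<close>

definition intermediate_limit ::
  "(nat \<Rightarrow> 'a metric) \<Rightarrow> real \<Rightarrow> 'b metric \<Rightarrow> 'b metric \<Rightarrow> ('b \<Rightarrow> 'b) \<Rightarrow> 'b set \<Rightarrow> bool" where
  "intermediate_limit m \<delta> Y' Y f S \<longleftrightarrow>
     f ` mspace Y \<subseteq> S \<and> S \<subseteq> mspace Y' \<and> compact_metric (submetric Y' S) \<and>
     (\<exists>r. strict_mono r \<and>
          GH_converges (\<lambda>k. inner_completion (m (r k)) \<delta>) (submetric Y' S))"

end

theory Submission
  imports Defs "HOL-Library.Diagonal_Subsequence"
begin

text \<open>Fix consecutive depths \<open>\<delta>' \<le> \<delta>\<close> and write \<open>X j\<close> for the completed inner region of depth \<open>\<delta>'\<close>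
  of the j-th manifold, \<open>Y'\<close> and \<open>Y\<close> for the limits at depths \<open>\<delta>'\<close> and \<open>\<delta>\<close>. Gromov-Hausdorff
  convergence of \<open>X j\<close> to \<open>Y'\<close> becomes Hausdorff convergence inside a single compact space \<open>Z\<close>
  that contains isometric copies of \<open>Y'\<close> and of every compact \<open>X j\<close>
  (\<open>common_compact_space\<close>). In \<open>Z\<close>, the copies \<open>A j \<subseteq> X j\<close> of the regions of depth \<open>\<delta>\<close> are
  sets in a compact space, so a subsequence has a compact Hausdorff limit \<open>K\<close>
  (Blaschke selection, \<open>compact_metric_hausdorff_subsequence\<close>), and \<open>K\<close> lies in the copy
  \<open>\<psi> ` Y'\<close> because \<open>A j \<subseteq> X j\<close>. Since \<open>A j\<close> is isometric to the completed inner region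
  of depth \<open>\<delta>\<close>, both \<open>Y\<close> and \<open>K\<close> are Gromov-Hausdorff limits of the same spaces; hence there is
  an isometry g of \<open>Y\<close> onto \<open>K\<close> (\<open>GH_limit_isometric_hausdorff_limit\<close>). The map
  \<open>\<psi>\<^sup>-\<^sup>1 \<circ> g\<close> is the subsequential limit embedding of \<open>Y\<close> into \<open>Y'\<close>. If \<open>\<delta>' = \<delta>\<close>, then
  \<open>K = \<psi> ` Y'\<close> is a Hausdorff limit without passing to a subsequence, so that the identity is
  an admissible choice.

  At an intermediate depth d the copies \<open>B j\<close> of the regions of depth d satisfy
  \<open>A j \<subseteq> B j \<subseteq> X j\<close>. Selecting again, now along the subsequence that produced \<open>K\<close>, gives a
  limit \<open>L\<close> with \<open>K \<subseteq> L \<subseteq> \<psi> ` Y'\<close>, and the preimage of \<open>L\<close> under \<open>\<psi>\<close> is the space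
  \<open>Y\<^sup>d\<close> that is asked for. The inclusions hold because inner
  regions shrink as the depth grows. Convergence at depth d also asks for compact spaces: a
  completed inner region is complete, hence its canonical copy inside a compact \<open>X j\<close> is closed
  (\<open>compact_inner_completion_in\<close>).\<close>

section \<open>Compactness, isometric embeddings and Hausdorff closeness\<close>

lemma mdist_self [simp]: "x \<in> mspace X \<Longrightarrow> mdist X x x = 0"
  by (rule mdist_zero[THEN iffD2]) auto

lemma compactin_metric_sequentially:
  "compactin (mtopology_of X) S \<longleftrightarrow> S \<subseteq> mspace X \<and>
     (\<forall>\<sigma>. range \<sigma> \<subseteq> S \<longrightarrow>
        (\<exists>l\<in>S. \<exists>r::nat\<Rightarrow>nat. strict_mono r \<and> (\<lambda>n. mdist X (\<sigma> (r n)) l) \<longlonglongrightarrow> 0))"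
proof -
  interpret Metric_space "mspace X" "mdist X" by simp
  have lim: "limitin mtopology (\<sigma> \<circ> r) l sequentially \<longleftrightarrow> (\<lambda>n. mdist X (\<sigma> (r n)) l) \<longlonglongrightarrow> 0"
    if "S \<subseteq> mspace X" "range \<sigma> \<subseteq> S" "l \<in> S" for \<sigma> l and r :: "nat \<Rightarrow> nat"
    using that by (auto simp: limitin_metric_dist_null o_def intro!: always_eventually)
  show ?thesis
    unfolding mtopology_of_def compactin_sequentially using lim by blast
qed

lemma compact_metric_sequentially:
  "compact_metric X \<longleftrightarrow>
     (\<forall>\<sigma>. range \<sigma> \<subseteq> mspace X \<longrightarrow>
        (\<exists>l\<in>mspace X. \<exists>r::nat\<Rightarrow>nat. strict_mono r \<and> (\<lambda>n. mdist X (\<sigma> (r n)) l) \<longlonglongrightarrow> 0))"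
  by (simp add: compact_space_def compactin_metric_sequentially)

lemma compactin_metric_subsequence:
  assumes "compactin (mtopology_of X) S" "\<And>n::nat. \<sigma> n \<in> S"
  obtains l r where "l \<in> S" "strict_mono (r::nat\<Rightarrow>nat)" "(\<lambda>n. mdist X (\<sigma> (r n)) l) \<longlonglongrightarrow> 0"
proof -
  have "range \<sigma> \<subseteq> S" using assms(2) by auto
  then show ?thesis
    using assms(1)[unfolded compactin_metric_sequentially] that by blast
qed

lemma compact_metric_subsequence:
  assumes "compact_metric X" "\<And>n::nat. \<sigma> n \<in> mspace X"
  obtains l r where "l \<in> mspace X" "strict_mono (r::nat\<Rightarrow>nat)"
    "(\<lambda>n. mdist X (\<sigma> (r n)) l) \<longlonglongrightarrow> 0"
  using compactin_metric_subsequence[of X "mspace X" \<sigma>] assms unfolding compact_space_def by auto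

lemma isometric_embeddingD:
  assumes "isometric_embedding X Y f"
  shows "x \<in> mspace X \<Longrightarrow> f x \<in> mspace Y"
    and "x \<in> mspace X \<Longrightarrow> y \<in> mspace X \<Longrightarrow> mdist Y (f x) (f y) = mdist X x y"
  using assms by (auto simp: isometric_embedding_def)

lemma isometric_embedding_inj_on:
  assumes "isometric_embedding X Y f" shows "inj_on f (mspace X)"
  using isometric_embeddingD[OF assms] by (intro inj_onI) (metis mdist_zero)

lemma isometric_embedding_compose:
  "isometric_embedding X Y f \<Longrightarrow> isometric_embedding Y Z g \<Longrightarrow> isometric_embedding X Z (g \<circ> f)"
  by (auto simp: isometric_embedding_def Pi_iff)

lemma compactin_isometric_image_iff:
  assumes f: "isometric_embedding X Z f"
  shows "compactin (mtopology_of Z) (f ` mspace X) \<longleftrightarrow> compact_metric X"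
proof
  note fD = isometric_embeddingD[OF f]
  assume L: "compactin (mtopology_of Z) (f ` mspace X)"
  show "compact_metric X"
    unfolding compact_metric_sequentially
  proof (intro allI impI)
    fix \<sigma> :: "nat \<Rightarrow> 'a" assume \<sigma>: "range \<sigma> \<subseteq> mspace X"
    then have "range (f \<circ> \<sigma>) \<subseteq> f ` mspace X" by auto
    then obtain z r where z: "z \<in> f ` mspace X" "strict_mono (r::nat\<Rightarrow>nat)"
        "(\<lambda>n. mdist Z ((f \<circ> \<sigma>) (r n)) z) \<longlonglongrightarrow> 0"
      using L unfolding compactin_metric_sequentially by blast
    then obtain l where l: "l \<in> mspace X" "strict_mono r"
        "(\<lambda>n. mdist Z (f (\<sigma> (r n))) (f l)) \<longlonglongrightarrow> 0"
      by auto
    moreover have "mdist Z (f (\<sigma> (r n))) (f l) = mdist X (\<sigma> (r n)) l" for n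
      using \<sigma> l by (intro fD) auto
    ultimately show "\<exists>l\<in>mspace X. \<exists>r::nat\<Rightarrow>nat. strict_mono r \<and> (\<lambda>n. mdist X (\<sigma> (r n)) l) \<longlonglongrightarrow> 0"
      by auto
  qed
next
  note fD = isometric_embeddingD[OF f]
  assume R: "compact_metric X"
  show "compactin (mtopology_of Z) (f ` mspace X)"
    unfolding compactin_metric_sequentially
  proof (intro conjI allI impI)
    show "f ` mspace X \<subseteq> mspace Z" using fD by auto
    fix \<sigma> :: "nat \<Rightarrow> 'b" assume \<sigma>: "range \<sigma> \<subseteq> f ` mspace X"
    then have "\<forall>n. \<exists>x. x \<in> mspace X \<and> \<sigma> n = f x" by auto
    then obtain \<tau> where \<tau>: "\<And>n. \<tau> n \<in> mspace X" "\<And>n. \<sigma> n = f (\<tau> n)" by metis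
    obtain l r where l: "l \<in> mspace X" "strict_mono (r::nat\<Rightarrow>nat)"
        "(\<lambda>n. mdist X (\<tau> (r n)) l) \<longlonglongrightarrow> 0"
      using compact_metric_subsequence[OF R \<tau>(1)] .
    have "mdist Z (\<sigma> (r n)) (f l) = mdist X (\<tau> (r n)) l" for n
      using \<tau> l by (simp add: fD)
    then show "\<exists>l\<in>f ` mspace X. \<exists>r::nat\<Rightarrow>nat. strict_mono r \<and> (\<lambda>n. mdist Z (\<sigma> (r n)) l) \<longlonglongrightarrow> 0"
      using l by (intro bexI[of _ "f l"] exI[of _ r]) auto
  qed
qed

lemma compactin_metric_closed:
  assumes "compactin (mtopology_of X) K" "x \<in> mspace X" "\<And>\<epsilon>. 0 < \<epsilon> \<Longrightarrow> \<exists>k\<in>K. mdist X x k \<le> \<epsilon>"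
  shows "x \<in> K"
proof -
  interpret Metric_space "mspace X" "mdist X" by simp
  have cl: "closedin mtopology K"
    using assms(1) Hausdorff_space_mtopology by (simp add: mtopology_of_def compactin_imp_closedin)
  show ?thesis
  proof (rule ccontr)
    assume "x \<notin> K"
    then obtain r where r: "0 < r" "disjnt K (mball x r)"
      using cl assms(2) unfolding closedin_metric by blast
    obtain k where "k \<in> K" "mdist X x k \<le> r/2" using assms(3)[of "r/2"] r(1) by auto
    moreover have "k \<in> mspace X" using closedin_subset[OF cl] \<open>k \<in> K\<close> by auto
    ultimately show False using r assms(2) by (auto simp: disjnt_iff)
  qed
qed

text \<open>A subset of a compact metric space that contains the limits of its sequences is compact; this is
  how the regions inside a completed inner region are recognised as compact.\<close>

lemma compactin_metric_closedI:
  assumes X: "compact_metric X" and C: "C \<subseteq> mspace X"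
    and cl: "\<And>x. x \<in> mspace X \<Longrightarrow> (\<And>\<epsilon>. 0 < \<epsilon> \<Longrightarrow> \<exists>c\<in>C. mdist X x c < \<epsilon>) \<Longrightarrow> x \<in> C"
  shows "compactin (mtopology_of X) C"
  unfolding compactin_metric_sequentially
proof (intro conjI allI impI C)
  fix \<sigma> :: "nat \<Rightarrow> 'a" assume \<sigma>: "range \<sigma> \<subseteq> C"
  then have "\<And>n. \<sigma> n \<in> mspace X" using C by auto
  from compact_metric_subsequence[OF X this]
  obtain l r where l: "l \<in> mspace X" "strict_mono (r::nat\<Rightarrow>nat)"
      "(\<lambda>n. mdist X (\<sigma> (r n)) l) \<longlonglongrightarrow> 0" .
  have "l \<in> C"
  proof (rule cl[OF l(1)])
    fix \<epsilon> :: real assume "0 < \<epsilon>"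
    then have "\<forall>\<^sub>F n in sequentially. mdist X (\<sigma> (r n)) l < \<epsilon>" using l(3) order_tendstoD(2) by blast
    then obtain n where "mdist X (\<sigma> (r n)) l < \<epsilon>" using eventually_happens'[OF sequentially_bot] by blast
    then show "\<exists>c\<in>C. mdist X l c < \<epsilon>" using \<sigma> mdist_commute[of X l] by auto
  qed
  then show "\<exists>l\<in>C. \<exists>r::nat\<Rightarrow>nat. strict_mono r \<and> (\<lambda>n. mdist X (\<sigma> (r n)) l) \<longlonglongrightarrow> 0" using l by blast
qed

text \<open>For \<open>\<epsilon> > 0\<close> this is the relation that a Hausdorff distance below \<open>\<epsilon>\<close> implies and that bounds the
  Hausdorff distance by \<open>\<epsilon>\<close>. It keeps the extended nonnegative reals out of all later estimates.\<close>

definition hausdorff_close :: "'a metric \<Rightarrow> real \<Rightarrow> 'a set \<Rightarrow> 'a set \<Rightarrow> bool" where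
  "hausdorff_close m \<epsilon> A B \<longleftrightarrow>
     (\<forall>a\<in>A. \<exists>b\<in>B. mdist m a b \<le> \<epsilon>) \<and> (\<forall>b\<in>B. \<exists>a\<in>A. mdist m a b \<le> \<epsilon>)"

lemma hausdorff_close_mono: "hausdorff_close m \<epsilon> A B \<Longrightarrow> \<epsilon> \<le> \<epsilon>' \<Longrightarrow> hausdorff_close m \<epsilon>' A B"
  unfolding hausdorff_close_def by (meson order_trans)

lemma hausdorff_dist_le: "hausdorff_close m \<epsilon> A B \<Longrightarrow> 0 \<le> \<epsilon> \<Longrightarrow> hausdorff_dist m A B \<le> ennreal \<epsilon>"
  unfolding hausdorff_dist_def hausdorff_close_def by (intro Inf_lower) blast

lemma hausdorff_dist_lessD:
  assumes "hausdorff_dist m A B < ennreal \<epsilon>" shows "hausdorff_close m \<epsilon> A B"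
proof -
  obtain r where r: "0 \<le> r" "hausdorff_close m r A B" "ennreal r < ennreal \<epsilon>"
    using assms unfolding hausdorff_dist_def Inf_less_iff hausdorff_close_def by auto
  then show ?thesis using hausdorff_close_mono by (metis ennreal_less_iff less_imp_le)
qed

lemma ennreal_tendsto_0_iff:
  fixes f :: "nat \<Rightarrow> ennreal"
  shows "f \<longlonglongrightarrow> 0 \<longleftrightarrow> (\<forall>\<epsilon>>0. \<forall>\<^sub>F n in sequentially. f n < ennreal \<epsilon>)"
proof
  assume "f \<longlonglongrightarrow> 0"
  then show "\<forall>\<epsilon>>0. \<forall>\<^sub>F n in sequentially. f n < ennreal \<epsilon>" by (simp add: order_tendstoD(2))
next
  assume R: "\<forall>\<epsilon>>0. \<forall>\<^sub>F n in sequentially. f n < ennreal \<epsilon>"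
  show "f \<longlonglongrightarrow> 0"
  proof (rule order_tendstoI)
    fix a :: ennreal assume "0 < a"
    then obtain b where "0 < b" "b < a" using dense by blast
    then obtain r where "b = ennreal r" "0 \<le> r" by (cases b rule: ennreal_cases) auto
    with \<open>0 < b\<close> \<open>b < a\<close> have "0 < r" "ennreal r < a" by (auto simp: ennreal_less_iff)
    with R have "\<forall>\<^sub>F n in sequentially. f n < ennreal r" by blast
    then show "\<forall>\<^sub>F n in sequentially. f n < a"
      by (rule eventually_mono) (use \<open>ennreal r < a\<close> in auto)
  qed simp
qed

lemma hausdorff_converges_iff:
  "hausdorff_converges m A B \<longleftrightarrow> (\<forall>\<epsilon>>0. \<forall>\<^sub>F j in sequentially. hausdorff_close m \<epsilon> (A j) B)"
proof
  assume "hausdorff_converges m A B"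
  then have *: "\<forall>\<epsilon>>0. \<forall>\<^sub>F j in sequentially. hausdorff_dist m (A j) B < ennreal \<epsilon>"
    unfolding hausdorff_converges_def ennreal_tendsto_0_iff .
  show "\<forall>\<epsilon>>0. \<forall>\<^sub>F j in sequentially. hausdorff_close m \<epsilon> (A j) B"
    by (intro allI impI eventually_mono[OF *[rule_format]] hausdorff_dist_lessD)
next
  assume R: "\<forall>\<epsilon>>0. \<forall>\<^sub>F j in sequentially. hausdorff_close m \<epsilon> (A j) B"
  show "hausdorff_converges m A B"
    unfolding hausdorff_converges_def ennreal_tendsto_0_iff
  proof (intro allI impI)
    fix \<epsilon> :: real assume "0 < \<epsilon>"
    then have "\<forall>\<^sub>F j in sequentially. hausdorff_close m (\<epsilon>/2) (A j) B" using R by simp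
    then show "\<forall>\<^sub>F j in sequentially. hausdorff_dist m (A j) B < ennreal \<epsilon>"
    proof (rule eventually_mono)
      fix j assume "hausdorff_close m (\<epsilon>/2) (A j) B"
      then have "hausdorff_dist m (A j) B \<le> ennreal (\<epsilon>/2)" using \<open>0 < \<epsilon>\<close> by (simp add: hausdorff_dist_le)
      also have "\<dots> < ennreal \<epsilon>" using \<open>0 < \<epsilon>\<close> by (simp add: ennreal_less_iff)
      finally show "hausdorff_dist m (A j) B < ennreal \<epsilon>" .
    qed
  qed
qed

lemma GH_dist_lessD:
  fixes X :: "'a metric" and Y :: "'b metric"
  assumes "GH_dist X Y < ennreal \<epsilon>"
  obtains Z :: "('a + 'b) metric" and f g
  where "isometric_embedding X Z f" "isometric_embedding Y Z g"
    "hausdorff_close Z \<epsilon> (f ` mspace X) (g ` mspace Y)"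
proof -
  obtain Z :: "('a + 'b) metric" and f g
    where Z: "hausdorff_dist Z (f ` mspace X) (g ` mspace Y) < ennreal \<epsilon>"
      "isometric_embedding X Z f" "isometric_embedding Y Z g"
    using assms unfolding GH_dist_def Inf_less_iff by blast
  from Z(2,3) hausdorff_dist_lessD[OF Z(1)] show ?thesis by (rule that)
qed

text \<open>Carries a metric to another type along an injection. Only the points in the image matter; the
  arbitrary values of \<^const>\<open>inv_into\<close> elsewhere still give a symmetric nonnegative function.\<close>

definition pushforward :: "('a \<Rightarrow> 'b) \<Rightarrow> 'a metric \<Rightarrow> 'b metric" where
  "pushforward f X = metric (f ` mspace X,
     \<lambda>u v. mdist X (inv_into (mspace X) f u) (inv_into (mspace X) f v))"

lemma pushforward:
  assumes "inj_on f (mspace X)"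
  shows mspace_pushforward: "mspace (pushforward f X) = f ` mspace X"
    and pushforward_isometric: "isometric_embedding X (pushforward f X) f"
proof -
  have M: "Metric_space (f ` mspace X)
     (\<lambda>u v. mdist X (inv_into (mspace X) f u) (inv_into (mspace X) f v))"
    using assms by unfold_locales (auto simp: mdist_commute intro: mdist_triangle)
  show "mspace (pushforward f X) = f ` mspace X"
    unfolding pushforward_def by (rule Metric_space.mspace_metric[OF M])
  then show "isometric_embedding X (pushforward f X) f"
    using assms unfolding isometric_embedding_def pushforward_def Metric_space.mdist_metric[OF M]
    by auto
qed

lemma compact_metric_pushforward:
  assumes "inj_on f (mspace X)"
  shows "compact_metric (pushforward f X) \<longleftrightarrow> compact_metric X"
  using compactin_isometric_image_iff[OF pushforward_isometric[OF assms]]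
  by (simp add: compact_space_def mspace_pushforward[OF assms])

text \<open>Gromov-Hausdorff distance is an infimum over ambient metrics on one particular sum type. An ambient
  space on any other type is as good: the union of the two images can be renamed by points of the
  sum, naming a common point after its preimage in the first space.\<close>

lemma GH_dist_le_hausdorff_dist:
  fixes X :: "'a metric" and Y :: "'b metric" and Z :: "'c metric"
  assumes f: "isometric_embedding X Z f" and g: "isometric_embedding Y Z g"
  shows "GH_dist X Y \<le> hausdorff_dist Z (f ` mspace X) (g ` mspace Y)"
proof -
  define W where "W = submetric Z (f ` mspace X \<union> g ` mspace Y)"
  define h :: "'c \<Rightarrow> 'a + 'b" where
    "h z = (if z \<in> f ` mspace X then Inl (inv_into (mspace X) f z) else Inr (inv_into (mspace Y) g z))" for z
  have W: "mspace W = f ` mspace X \<union> g ` mspace Y" "mdist W = mdist Z"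
    using isometric_embeddingD(1)[OF f] isometric_embeddingD(1)[OF g] by (auto simp: W_def)
  have inj: "inj_on h (mspace W)"
    unfolding W by (intro inj_onI) (auto simp: h_def split: if_splits dest!: inv_into_injective)
  define V where "V = pushforward h W"
  note h = isometric_embeddingD[OF pushforward_isometric[OF inj], folded V_def]
  have f': "isometric_embedding X W f" and g': "isometric_embedding Y W g"
    using f g W by (auto simp: isometric_embedding_def)
  note f'' = isometric_embedding_compose[OF f' pushforward_isometric[OF inj], folded V_def]
  note g'' = isometric_embedding_compose[OF g' pushforward_isometric[OF inj], folded V_def]
  have eq: "mdist V (h (f x)) (h (g y)) = mdist Z (f x) (g y)" if "x \<in> mspace X" "y \<in> mspace Y" for x y
    using that h(2) W by auto
  have "hausdorff_dist V ((h \<circ> f) ` mspace X) ((h \<circ> g) ` mspace Y) =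
        hausdorff_dist Z (f ` mspace X) (g ` mspace Y)"
    unfolding hausdorff_dist_def by (simp add: eq cong: bex_cong ball_cong)
  moreover have "GH_dist X Y \<le> hausdorff_dist V ((h \<circ> f) ` mspace X) ((h \<circ> g) ` mspace Y)"
    unfolding GH_dist_def using f'' g'' by (intro Inf_lower) blast
  ultimately show ?thesis by simp
qed

section \<open>Hausdorff limits of subsets of a compact space\<close>

lemma compact_metric_finite_net:
  assumes "compact_metric X" "0 < \<epsilon>"
  obtains K where "finite K" "K \<subseteq> mspace X" "\<And>x. x \<in> mspace X \<Longrightarrow> \<exists>k\<in>K. mdist X x k < \<epsilon>"
proof -
  interpret Metric_space "mspace X" "mdist X" by simp
  have "mtotally_bounded (mspace X)"
    using assms(1) by (intro compactin_imp_mtotally_bounded) (simp add: compact_space_def mtopology_of_def)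
  then have "\<exists>K. finite K \<and> K \<subseteq> mspace X \<and> mspace X \<subseteq> (\<Union>x\<in>K. mball x \<epsilon>)"
    using assms(2) by (simp add: mtotally_bounded_def)
  then obtain K where K: "finite K" "K \<subseteq> mspace X" "mspace X \<subseteq> (\<Union>x\<in>K. mball x \<epsilon>)"
    by blast
  show ?thesis
  proof (rule that[OF K(1,2)])
    fix x assume "x \<in> mspace X"
    then obtain k where "k \<in> K" "x \<in> mball k \<epsilon>" using K(3) by blast
    then show "\<exists>k\<in>K. mdist X x k < \<epsilon>" using mdist_commute[of X x k] by (intro bexI[of _ k]) auto
  qed
qed

lemma compact_metric_dense_sequence:
  assumes "compact_metric X" "mspace X \<noteq> {}"
  obtains z :: "nat \<Rightarrow> 'a" where "\<And>n. z n \<in> mspace X"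
    "\<And>x \<epsilon>. x \<in> mspace X \<Longrightarrow> 0 < \<epsilon> \<Longrightarrow> \<exists>n. mdist X x (z n) < \<epsilon>"
proof -
  have "\<forall>n. \<exists>K. finite K \<and> K \<subseteq> mspace X \<and> (\<forall>x\<in>mspace X. \<exists>k\<in>K. mdist X x k < inverse (real (Suc n)))"
  proof
    fix n
    have "0 < inverse (real (Suc n))" by simp
    from compact_metric_finite_net[OF assms(1) this]
    obtain K where "finite K" "K \<subseteq> mspace X"
      "\<And>x. x \<in> mspace X \<Longrightarrow> \<exists>k\<in>K. mdist X x k < inverse (real (Suc n))" by blast
    then show "\<exists>K. finite K \<and> K \<subseteq> mspace X \<and> (\<forall>x\<in>mspace X. \<exists>k\<in>K. mdist X x k < inverse (real (Suc n)))"
      by (intro exI[of _ K]) blast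
  qed
  then obtain K where "\<forall>n. finite (K n) \<and> K n \<subseteq> mspace X \<and>
      (\<forall>x\<in>mspace X. \<exists>k\<in>K n. mdist X x k < inverse (real (Suc n)))"
    by (rule choice[THEN exE])
  then have K: "\<And>n. finite (K n)" "\<And>n. K n \<subseteq> mspace X"
    "\<And>n x. x \<in> mspace X \<Longrightarrow> \<exists>k\<in>K n. mdist X x k < inverse (real (Suc n))"
    by auto
  define D where "D = (\<Union>n. K n)"
  have "countable D" unfolding D_def using K(1) by (intro countable_UN) (auto intro: countable_finite)
  moreover have "D \<noteq> {}" unfolding D_def using K(3)[of _ 0] assms(2) by blast
  moreover have "D \<subseteq> mspace X" unfolding D_def using K(2) by blast
  ultimately have D: "countable D" "D \<subseteq> mspace X" "D \<noteq> {}" by blast+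
  show ?thesis
  proof (rule that[of "from_nat_into D"])
    show "from_nat_into D n \<in> mspace X" for n using D from_nat_into[of D n] by auto
    fix x and \<epsilon> :: real assume x: "x \<in> mspace X" and "0 < \<epsilon>"
    then obtain n where n: "inverse (real (Suc n)) < \<epsilon>" using reals_Archimedean by blast
    obtain k where "k \<in> K n" "mdist X x k < inverse (real (Suc n))" using K(3)[OF x] by blast
    moreover obtain i where "k = from_nat_into D i"
      using from_nat_into_surj[OF D(1), of k] \<open>k \<in> K n\<close> unfolding D_def by blast
    ultimately show "\<exists>i. mdist X x (from_nat_into D i) < \<epsilon>" using n by (intro exI[of _ i]) simp
  qed
qed

text \<open>Take an arbitrary finite net of half the scale and move its points into the dense sequence.\<close>

lemma compact_metric_finite_subnet:
  assumes X: "compact_metric X" and z: "\<And>n::nat. z n \<in> mspace X"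
    "\<And>x \<epsilon>. x \<in> mspace X \<Longrightarrow> 0 < \<epsilon> \<Longrightarrow> \<exists>n. mdist X x (z n) < \<epsilon>" and "0 < \<epsilon>"
  obtains I where "finite I" "\<And>x. x \<in> mspace X \<Longrightarrow> \<exists>i\<in>I. mdist X x (z i) < \<epsilon>"
proof -
  obtain K where K: "finite K" "K \<subseteq> mspace X" "\<And>x. x \<in> mspace X \<Longrightarrow> \<exists>k\<in>K. mdist X x k < \<epsilon>/2"
    using compact_metric_finite_net[OF X, of "\<epsilon>/2"] \<open>0 < \<epsilon>\<close> by auto
  have "0 < \<epsilon>/2" using \<open>0 < \<epsilon>\<close> by simp
  then have "\<forall>k\<in>K. \<exists>n. mdist X k (z n) < \<epsilon>/2" using K(2) z(2) by blast
  then obtain j where j: "\<forall>k\<in>K. mdist X k (z (j k)) < \<epsilon>/2" by (rule bchoice[THEN exE])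
  show ?thesis
  proof (rule that[of "j ` K"])
    fix x assume x: "x \<in> mspace X"
    then obtain k where k: "k \<in> K" "mdist X x k < \<epsilon>/2" using K(3) by blast
    have "mdist X x (z (j k)) \<le> mdist X x k + mdist X k (z (j k))"
      using x k(1) K(2) z(1) by (intro mdist_triangle) auto
    then show "\<exists>i\<in>j ` K. mdist X x (z i) < \<epsilon>" using k j by force
  qed (use K in simp)
qed

text \<open>Blaschke's selection theorem. Consider the countably many balls with centres in a dense sequence
  and radii \<open>1/(m+1)\<close>. A diagonal argument yields a subsequence along which each of these balls is
  either met by almost all sets or missed by almost all of them. The limit consists of the points
  all of whose neighbourhoods are met by almost all sets of the subsequence. For a given
  \<open>\<epsilon>\<close>, finitely many balls of one small radius cover the space, so from some index on each of them
  is met exactly if it is met almost always, and this compares the sets with the limit.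

  Empty sets fit in: if all balls of such a finite cover are missed almost always, then the selected
  sets are eventually empty, and so is the limit.\<close>

theorem compact_metric_hausdorff_subsequence:
  fixes Z :: "'a metric"
  assumes Z: "compact_metric Z" and A: "\<And>n. A n \<subseteq> mspace Z"
  obtains K r where "strict_mono (r::nat\<Rightarrow>nat)" "compactin (mtopology_of Z) K"
    "hausdorff_converges Z (\<lambda>k. A (r k)) K"
proof (cases "mspace Z = {}")
  case True
  then have "A n = {}" for n using A by blast
  then have "hausdorff_converges Z (\<lambda>k. A (id k)) {}"
    unfolding hausdorff_converges_iff hausdorff_close_def by simp
  then show ?thesis by (intro that[of id "{}"]) (auto simp: strict_mono_id)
next
  case False
  obtain z :: "nat \<Rightarrow> 'a" where z: "\<And>n. z n \<in> mspace Z"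
    "\<And>x \<epsilon>. x \<in> mspace Z \<Longrightarrow> 0 < \<epsilon> \<Longrightarrow> \<exists>n. mdist Z x (z n) < \<epsilon>"
    using compact_metric_dense_sequence[OF Z False] by blast
  define rad where "rad m = inverse (real (Suc m))" for m
  have rad: "0 < rad m" for m by (simp add: rad_def)
  define meets where "meets i m k \<longleftrightarrow> (\<exists>a\<in>A k. mdist Z a (z i) < rad m)" for i m k
  define P where "P n s \<longleftrightarrow> (case prod_decode n of (i, m) \<Rightarrow>
      (\<forall>\<^sub>F k in sequentially. meets i m (s k)) \<or> (\<forall>\<^sub>F k in sequentially. \<not> meets i m (s k)))"
    for n and s :: "nat \<Rightarrow> nat"
  interpret subseqs P
  proof
    fix n and s :: "nat \<Rightarrow> nat" assume "strict_mono s"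
    obtain i m where im: "prod_decode n = (i, m)" by fastforce
    show "\<exists>r'. strict_mono r' \<and> P n (s \<circ> r')"
    proof (cases "infinite {k. meets i m (s k)}")
      case True
      then have "meets i m (s (enumerate {k. meets i m (s k)} k))" for k
        using enumerate_in_set by blast
      then have "P n (s \<circ> enumerate {k. meets i m (s k)})"
        unfolding P_def im by simp
      then show ?thesis using strict_mono_enumerate[OF True] by blast
    next
      case False
      then have "\<forall>\<^sub>F k in sequentially. \<not> meets i m (s k)"
        by (simp add: eventually_cofinite flip: cofinite_eq_sequentially)
      then have "P n (s \<circ> id)" unfolding P_def im by simp
      then show ?thesis using strict_mono_id by blast
    qed
  qed
  define r where "r = diagseq"
  have r: "strict_mono r" using subseq_diagseq by (simp add: r_def)
  have dec: "(\<forall>\<^sub>F k in sequentially. meets i m (r k)) \<or> (\<forall>\<^sub>F k in sequentially. \<not> meets i m (r k))" for i m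
  proof -
    \<comment> \<open>The diagonal sequence is a subsequence of the n-th selected one only from index \<open>Suc n\<close> on.\<close>
    define c where "c = Suc (prod_encode (i, m))"
    have stable: "P n (s \<circ> t)" if t: "strict_mono t" and P: "P n s" for n s t
    proof -
      obtain i m where "prod_decode n = (i, m)" by fastforce
      then show ?thesis
        using P eventually_subseq[OF t, of "\<lambda>k. meets i m (s k)"]
          eventually_subseq[OF t, of "\<lambda>k. \<not> meets i m (s k)"] by (auto simp: P_def)
    qed
    have "P (prod_encode (i, m)) (diagseq \<circ> (+) c)"
      unfolding c_def using stable by (rule diagseq_holds)
    then have "(\<forall>\<^sub>F k in sequentially. meets i m (r (k + c))) \<or>
        (\<forall>\<^sub>F k in sequentially. \<not> meets i m (r (k + c)))"
      by (simp add: P_def r_def add.commute)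
    then show ?thesis
      unfolding eventually_sequentially_seg[of "\<lambda>k. meets i m (r k)"]
        eventually_sequentially_seg[of "\<lambda>k. \<not> meets i m (r k)"] .
  qed
  define K where "K = {w \<in> mspace Z. \<forall>\<eta>>0. \<forall>\<^sub>F k in sequentially. \<exists>a\<in>A (r k). mdist Z w a < \<eta>}"
  have AZ: "a \<in> A k \<Longrightarrow> a \<in> mspace Z" for a k using A by blast
  have KD: "\<forall>\<^sub>F k in sequentially. \<exists>a\<in>A (r k). mdist Z w a < \<eta>" if "w \<in> K" "0 < \<eta>" for w \<eta>
    using that by (simp add: K_def)
  have KZ: "K \<subseteq> mspace Z" by (auto simp: K_def)
  have K: "compactin (mtopology_of Z) K"
  proof (rule compactin_metric_closedI[OF Z KZ])
    fix x assume x: "x \<in> mspace Z" "\<And>\<epsilon>. 0 < \<epsilon> \<Longrightarrow> \<exists>c\<in>K. mdist Z x c < \<epsilon>"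
    have "\<forall>\<^sub>F k in sequentially. \<exists>a\<in>A (r k). mdist Z x a < \<eta>" if \<eta>: "0 < \<eta>" for \<eta>
    proof -
      obtain c where c: "c \<in> K" "mdist Z x c < \<eta>/2" using x(2)[of "\<eta>/2"] \<eta> by auto
      have cZ: "c \<in> mspace Z" using c KZ by blast
      show ?thesis
      proof (rule eventually_mono[OF KD[OF c(1), of "\<eta>/2"]])
        fix k assume "\<exists>a\<in>A (r k). mdist Z c a < \<eta>/2"
        then obtain a where a: "a \<in> A (r k)" "mdist Z c a < \<eta>/2" by blast
        have "mdist Z x a \<le> mdist Z x c + mdist Z c a"
          using x(1) cZ AZ[OF a(1)] by (rule mdist_triangle)
        then show "\<exists>a\<in>A (r k). mdist Z x a < \<eta>" using a c by (intro bexI[of _ a]) auto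
      qed (use \<eta> in simp)
    qed
    then show "x \<in> K" using x(1) by (simp add: K_def)
  qed
  have conv: "hausdorff_converges Z (\<lambda>k. A (r k)) K"
    unfolding hausdorff_converges_iff
  proof (intro allI impI)
    fix \<epsilon> :: real assume \<epsilon>: "0 < \<epsilon>"
    obtain m where m: "rad m < \<epsilon>/2" using reals_Archimedean[of "\<epsilon>/2"] \<epsilon> unfolding rad_def by auto
    obtain I where I: "finite I" "\<And>x. x \<in> mspace Z \<Longrightarrow> \<exists>i\<in>I. mdist Z x (z i) < rad m"
      using compact_metric_finite_subnet[OF Z z rad[of m]] by blast
    have "\<forall>i\<in>I. \<forall>\<^sub>F k in sequentially. (meets i m (r k) \<and> (\<forall>\<^sub>F k in sequentially. meets i m (r k))) \<or>
         (\<not> meets i m (r k) \<and> (\<forall>\<^sub>F k in sequentially. \<not> meets i m (r k)))"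
    proof
      fix i
      show "\<forall>\<^sub>F k in sequentially. (meets i m (r k) \<and> (\<forall>\<^sub>F k in sequentially. meets i m (r k))) \<or>
         (\<not> meets i m (r k) \<and> (\<forall>\<^sub>F k in sequentially. \<not> meets i m (r k)))"
        using dec[of i m]
      proof
        assume *: "\<forall>\<^sub>F k in sequentially. meets i m (r k)"
        show ?thesis by (rule eventually_mono[OF *]) (use * in simp)
      next
        assume *: "\<forall>\<^sub>F k in sequentially. \<not> meets i m (r k)"
        show ?thesis by (rule eventually_mono[OF *]) (use * in simp)
      qed
    qed
    with I(1) have "\<forall>\<^sub>F k in sequentially. \<forall>i\<in>I. (meets i m (r k) \<and> (\<forall>\<^sub>F k in sequentially. meets i m (r k))) \<or>
         (\<not> meets i m (r k) \<and> (\<forall>\<^sub>F k in sequentially. \<not> meets i m (r k)))"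
      by (rule eventually_ball_finite)
    then show "\<forall>\<^sub>F k in sequentially. hausdorff_close Z \<epsilon> (A (r k)) K"
    proof (rule eventually_mono)
      fix k assume D: "\<forall>i\<in>I. (meets i m (r k) \<and> (\<forall>\<^sub>F k in sequentially. meets i m (r k))) \<or>
         (\<not> meets i m (r k) \<and> (\<forall>\<^sub>F k in sequentially. \<not> meets i m (r k)))"
      have 1: "\<exists>w\<in>K. mdist Z a w \<le> \<epsilon>" if a: "a \<in> A (r k)" for a
      proof -
        obtain i where i: "i \<in> I" "mdist Z a (z i) < rad m" using I(2)[OF AZ[OF a]] by blast
        then have "meets i m (r k)" using a by (auto simp: meets_def)
        then have "\<forall>\<^sub>F k in sequentially. meets i m (r k)" using D i by blast
        then obtain N where N: "\<And>k. N \<le> k \<Longrightarrow> meets i m (r k)"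
          unfolding eventually_sequentially by blast
        have "\<forall>n. \<exists>b. b \<in> A (r (N + n)) \<and> mdist Z b (z i) < rad m"
          using N unfolding meets_def by (meson le_add1)
        then obtain b where "\<forall>n. b n \<in> A (r (N + n)) \<and> mdist Z (b n) (z i) < rad m"
          by (rule choice[THEN exE])
        then have b: "\<And>n. b n \<in> A (r (N + n))" "\<And>n. mdist Z (b n) (z i) < rad m" by auto
        \<comment> \<open>A limit point of the points at which the later sets meet the ball lies in \<open>K\<close>.\<close>
        obtain w t where w: "w \<in> mspace Z" "strict_mono (t::nat\<Rightarrow>nat)" "(\<lambda>n. mdist Z (b (t n)) w) \<longlonglongrightarrow> 0"
          using compact_metric_subsequence[OF Z AZ[OF b(1)]] .
        have "\<forall>\<^sub>F k in sequentially. \<exists>a\<in>A (r k). mdist Z w a < \<eta>" if \<eta>: "0 < \<eta>" for \<eta>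
        proof -
          obtain m' where m': "rad m' < \<eta>/2"
            using reals_Archimedean[of "\<eta>/2"] \<eta> unfolding rad_def by auto
          obtain i' where i': "mdist Z w (z i') < rad m' / 2" using z(2)[OF w(1)] rad[of m'] by (metis half_gt_zero)
          have "\<forall>\<^sub>F n in sequentially. mdist Z (b (t n)) w < rad m' / 2"
            using w(3) rad[of m'] by (intro order_tendstoD(2)) auto
          then have *: "\<forall>\<^sub>F n in sequentially. meets i' m' (r (N + t n))"
          proof (rule eventually_mono)
            fix n assume "mdist Z (b (t n)) w < rad m' / 2"
            moreover have "mdist Z (b (t n)) (z i') \<le> mdist Z (b (t n)) w + mdist Z w (z i')"
              by (intro mdist_triangle AZ[OF b(1)] w z)
            ultimately show "meets i' m' (r (N + t n))"
              unfolding meets_def using b(1) i' by (intro bexI[of _ "b (t n)"]) auto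
          qed
          \<comment> \<open>Being met infinitely often rules out being missed almost always.\<close>
          have "\<not> (\<forall>\<^sub>F k in sequentially. \<not> meets i' m' (r k))"
          proof
            assume "\<forall>\<^sub>F k in sequentially. \<not> meets i' m' (r k)"
            moreover have "strict_mono (\<lambda>n. N + t n)" using w(2) by (simp add: strict_mono_def)
            ultimately have "\<forall>\<^sub>F n in sequentially. \<not> meets i' m' (r (N + t n))"
              using eventually_subseq by fastforce
            with * have "\<forall>\<^sub>F n::nat in sequentially. False" by eventually_elim simp
            then show False by simp
          qed
          with dec have "\<forall>\<^sub>F k in sequentially. meets i' m' (r k)" by blast
          then show ?thesis
          proof (rule eventually_mono)
            fix k assume "meets i' m' (r k)"
            then obtain a where a: "a \<in> A (r k)" "mdist Z a (z i') < rad m'" by (auto simp: meets_def)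
            have "mdist Z w a \<le> mdist Z w (z i') + mdist Z (z i') a"
              by (intro mdist_triangle AZ[OF a(1)] w z)
            then show "\<exists>a\<in>A (r k). mdist Z w a < \<eta>"
              using a i' m' mdist_commute[of Z a] rad[of m'] by (intro bexI[of _ a]) auto
          qed
        qed
        then have "w \<in> K" using w by (simp add: K_def)
        have "mdist Z a w \<le> mdist Z a (z i) + mdist Z (z i) (b (t n)) + mdist Z (b (t n)) w" for n
          using mdist_triangle[OF AZ[OF a] z(1) w(1), of i] mdist_triangle[OF z(1) AZ[OF b(1)] w(1), of i "t n"]
          by linarith
        then have "mdist Z a w \<le> \<epsilon> + mdist Z (b (t n)) w" for n
          using i(2) b(2)[of "t n"] m mdist_commute[of Z "z i"] by (smt (verit) field_sum_of_halves)
        moreover have "(\<lambda>n. \<epsilon> + mdist Z (b (t n)) w) \<longlonglongrightarrow> \<epsilon> + 0"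
          by (intro tendsto_intros w(3))
        ultimately have "mdist Z a w \<le> \<epsilon> + 0" by (intro LIMSEQ_le_const[of _ "\<epsilon> + 0"]) auto
        with \<open>w \<in> K\<close> show ?thesis by auto
      qed
      have 2: "\<exists>a\<in>A (r k). mdist Z a w \<le> \<epsilon>" if w: "w \<in> K" for w
      proof -
        have wZ: "w \<in> mspace Z" using w KZ by blast
        obtain i where i: "i \<in> I" "mdist Z w (z i) < rad m" using I(2)[OF wZ] by blast
        have "\<forall>\<^sub>F k in sequentially. meets i m (r k)"
        proof (rule eventually_mono[OF KD[OF w, of "rad m - mdist Z w (z i)"]])
          fix k assume "\<exists>a\<in>A (r k). mdist Z w a < rad m - mdist Z w (z i)"
          then obtain a where a: "a \<in> A (r k)" "mdist Z w a < rad m - mdist Z w (z i)" by blast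
          have "mdist Z a (z i) \<le> mdist Z a w + mdist Z w (z i)"
            by (intro mdist_triangle AZ[OF a(1)] wZ z)
          then show "meets i m (r k)" unfolding meets_def using a mdist_commute[of Z a w] by (intro bexI[of _ a]) auto
        qed (use i in simp)
        moreover have "\<not> (\<forall>\<^sub>F k in sequentially. \<not> meets i m (r k))"
        proof
          assume "\<forall>\<^sub>F k in sequentially. \<not> meets i m (r k)"
          with calculation have "\<forall>\<^sub>F n::nat in sequentially. False" by eventually_elim simp
          then show False by simp
        qed
        ultimately have "meets i m (r k)" using D i(1) by blast
        then obtain a where a: "a \<in> A (r k)" "mdist Z a (z i) < rad m" by (auto simp: meets_def)
        have "mdist Z a w \<le> mdist Z a (z i) + mdist Z (z i) w"
          by (intro mdist_triangle AZ[OF a(1)] wZ z)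
        then show ?thesis using a i m mdist_commute[of Z w] by (intro bexI[of _ a]) auto
      qed
      show "hausdorff_close Z \<epsilon> (A (r k)) K" unfolding hausdorff_close_def using 1 2 by blast
    qed
  qed
  show ?thesis by (rule that[OF r K conv])
qed

text \<open>A point of the smaller limit is arbitrarily close to the larger limit, which is closed.\<close>

lemma hausdorff_limit_mono:
  assumes A: "hausdorff_converges Z A K" and B: "hausdorff_converges Z B L"
    and sub: "\<forall>\<^sub>F n in sequentially. A n \<subseteq> B n \<and> B n \<subseteq> mspace Z"
    and K: "K \<subseteq> mspace Z" and L: "compactin (mtopology_of Z) L"
  shows "K \<subseteq> L"
proof
  fix w assume w: "w \<in> K"
  have LZ: "L \<subseteq> mspace Z" using compactin_subset_topspace[OF L] by simp
  show "w \<in> L"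
  proof (rule compactin_metric_closed[OF L])
    show wZ: "w \<in> mspace Z" using w K by blast
    fix \<epsilon> :: real assume "0 < \<epsilon>"
    then have "0 < \<epsilon>/2" by simp
    then have "\<forall>\<^sub>F n in sequentially. hausdorff_close Z (\<epsilon>/2) (A n) K"
        "\<forall>\<^sub>F n in sequentially. hausdorff_close Z (\<epsilon>/2) (B n) L"
      using A B unfolding hausdorff_converges_iff by blast+
    with sub have "\<forall>\<^sub>F n in sequentially. hausdorff_close Z (\<epsilon>/2) (A n) K \<and>
        hausdorff_close Z (\<epsilon>/2) (B n) L \<and> A n \<subseteq> B n \<and> B n \<subseteq> mspace Z"
      by eventually_elim simp
    then obtain n where n: "hausdorff_close Z (\<epsilon>/2) (A n) K" "hausdorff_close Z (\<epsilon>/2) (B n) L"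
        "A n \<subseteq> B n" "B n \<subseteq> mspace Z"
      using eventually_happens'[OF sequentially_bot] by blast
    obtain a where a: "a \<in> A n" "mdist Z a w \<le> \<epsilon>/2" using n(1) w unfolding hausdorff_close_def by blast
    obtain l where l: "l \<in> L" "mdist Z a l \<le> \<epsilon>/2" using n(2,3) a unfolding hausdorff_close_def by blast
    have "mdist Z w l \<le> mdist Z w a + mdist Z a l"
      using wZ a(1) n(3,4) l(1) LZ by (intro mdist_triangle) auto
    then show "\<exists>l\<in>L. mdist Z w l \<le> \<epsilon>" using a l mdist_commute[of Z w a] by (intro bexI[of _ l]) auto
  qed
qed

section \<open>Uniqueness of Gromov-Hausdorff limits\<close>

text \<open>Pairs of maps \<open>f : Y \<rightarrow> X\<close> and \<open>g : X \<rightarrow> Y\<close> form a compact space in the topology of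
  pointwise convergence (Tychonoff), and the approximate adjointness
  \<open>\<bar>d(f y, x) - d(y, g x)\<bar> \<le> \<epsilon>\<close> is a closed condition on the pair. So the nonempty closed
  sets of approximate pairs for \<open>\<epsilon> = 1/(n+1)\<close> have a common element, with
  \<open>d(f y, x) = d(y, g x)\<close> for all x and y. Putting \<open>x = f y\<close> and \<open>y = g x\<close> shows that f and g
  are mutually inverse, and then \<open>d(f y, f y') = d(y, g (f y')) = d(y, y')\<close>. Treating both maps at
  once gives surjectivity along with the isometry, whereas a limit of almost isometric maps
  \<open>Y \<rightarrow> X\<close> alone would have to be shown surjective separately.\<close>

lemma compact_metric_isometry_of_adjoint_approximations:
  fixes X :: "'a metric" and Y :: "'b metric"
  assumes X: "compact_metric X" and Y: "compact_metric Y"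
    and approx: "\<And>\<epsilon>. 0 < \<epsilon> \<Longrightarrow> \<exists>f g. f \<in> mspace Y \<rightarrow> mspace X \<and> g \<in> mspace X \<rightarrow> mspace Y \<and>
       (\<forall>y\<in>mspace Y. \<forall>x\<in>mspace X. \<bar>mdist X (f y) x - mdist Y y (g x)\<bar> \<le> \<epsilon>)"
  obtains f where "isometric_embedding Y X f" "f ` mspace Y = mspace X"
proof -
  define T where "T = prod_topology (product_topology (\<lambda>_. mtopology_of X) (mspace Y))
                                    (product_topology (\<lambda>_. mtopology_of Y) (mspace X))"
  have T: "compact_space T"
    unfolding T_def compact_space_prod_topology compact_space_product_topology using X Y by blast
  have topT: "topspace T = (mspace Y \<rightarrow>\<^sub>E mspace X) \<times> (mspace X \<rightarrow>\<^sub>E mspace Y)"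
    by (simp add: T_def)
  define E where "E \<epsilon> y x = {p \<in> topspace T. \<bar>mdist X (fst p y) x - mdist Y y (snd p x)\<bar> \<in> {..\<epsilon>}}"
    for \<epsilon> y x
  have E: "closedin T (E \<epsilon> y x)" if "y \<in> mspace Y" "x \<in> mspace X" for \<epsilon> y x
    unfolding E_def
  proof (rule closedin_continuous_map_preimage)
    have 1: "continuous_map T (mtopology_of X) (\<lambda>p. fst p y)"
      unfolding T_def
      using continuous_map_compose[OF continuous_map_fst continuous_map_product_projection[OF that(1)]]
      by (simp add: o_def)
    have 2: "continuous_map T (mtopology_of Y) (\<lambda>p. snd p x)"
      unfolding T_def
      using continuous_map_compose[OF continuous_map_snd continuous_map_product_projection[OF that(2)]]
      by (simp add: o_def)
    show "continuous_map T euclideanreal (\<lambda>p. \<bar>mdist X (fst p y) x - mdist Y y (snd p x)\<bar>)"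
      using that by (intro continuous_map_real_abs continuous_map_diff continuous_map_mdist 1 2) simp_all
  qed simp
  \<comment> \<open>Intersecting with the whole space keeps the families nonempty when X or Y is empty.\<close>
  define C where "C n = topspace T \<inter> (\<Inter>y\<in>mspace Y. topspace T \<inter> (\<Inter>x\<in>mspace X. E (inverse (real (Suc n))) y x))" for n
  have memC: "p \<in> C n \<longleftrightarrow> p \<in> topspace T \<and> (\<forall>y\<in>mspace Y. \<forall>x\<in>mspace X.
      \<bar>mdist X (fst p y) x - mdist Y y (snd p x)\<bar> \<le> inverse (real (Suc n)))" for p n
    unfolding C_def E_def by auto
  have "(\<Inter>n. C n) \<noteq> {}"
  proof (rule compact_space_imp_nest[OF T])
    show "closedin T (C n)" for n
    proof -
      have "closedin T (\<Inter> (insert (topspace T) ((\<lambda>x. E (inverse (real (Suc n))) y x) ` mspace X)))"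
        if "y \<in> mspace Y" for y
        using that E by (intro closedin_Inter) auto
      then have "closedin T (\<Inter> (insert (topspace T)
          ((\<lambda>y. topspace T \<inter> (\<Inter>x\<in>mspace X. E (inverse (real (Suc n))) y x)) ` mspace Y)))"
        by (intro closedin_Inter) auto
      then show ?thesis by (simp add: C_def)
    qed
    show "C n \<noteq> {}" for n
    proof -
      have "0 < inverse (real (Suc n))" by simp
      from approx[OF this] obtain f g where fg: "f \<in> mspace Y \<rightarrow> mspace X" "g \<in> mspace X \<rightarrow> mspace Y"
        "\<And>y x. y \<in> mspace Y \<Longrightarrow> x \<in> mspace X \<Longrightarrow> \<bar>mdist X (f y) x - mdist Y y (g x)\<bar> \<le> inverse (real (Suc n))"
        by blast
      have "(restrict f (mspace Y), restrict g (mspace X)) \<in> topspace T"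
        unfolding topT using fg(1,2) by auto
      then have "(restrict f (mspace Y), restrict g (mspace X)) \<in> C n"
        unfolding memC using fg(3) by simp
      then show ?thesis by blast
    qed
    have "C m \<subseteq> C n" if "n \<le> m" for n m
    proof -
      have "inverse (real (Suc m)) \<le> inverse (real (Suc n))" using that by (simp add: field_simps)
      then show ?thesis unfolding subset_iff memC by (meson order_trans)
    qed
    then show "decseq C" by (simp add: decseq_def)
  qed
  then obtain f g where p: "\<And>n. (f, g) \<in> C n" by fastforce
  then have fg: "f \<in> mspace Y \<rightarrow>\<^sub>E mspace X" "g \<in> mspace X \<rightarrow>\<^sub>E mspace Y"
    using memC topT by auto
  have adj: "mdist X (f y) x = mdist Y y (g x)" if "y \<in> mspace Y" "x \<in> mspace X" for x y
  proof -
    have "\<bar>mdist X (f y) x - mdist Y y (g x)\<bar> \<le> inverse (real (Suc n))" for n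
      using p[of n] that unfolding memC by auto
    then have "\<bar>mdist X (f y) x - mdist Y y (g x)\<bar> \<le> 0"
      by (intro LIMSEQ_le_const[OF LIMSEQ_inverse_real_of_nat]) blast
    then show ?thesis by simp
  qed
  have gf: "g (f y) = y" if y: "y \<in> mspace Y" for y
  proof -
    have fy: "f y \<in> mspace X" and gfy: "g (f y) \<in> mspace Y" using fg y by auto
    have "mdist Y y (g (f y)) = 0" using adj[OF y fy, symmetric] fy by simp
    then show ?thesis using y gfy by simp
  qed
  have fg': "f (g x) = x" if x: "x \<in> mspace X" for x
  proof -
    have gx: "g x \<in> mspace Y" and fgx: "f (g x) \<in> mspace X" using fg x by auto
    have "mdist X (f (g x)) x = 0" using adj[OF gx x] gx by simp
    then show ?thesis using x fgx by simp
  qed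
  show ?thesis
  proof (rule that)
    show "isometric_embedding Y X f"
      unfolding isometric_embedding_def
    proof (intro conjI ballI)
      show "f \<in> mspace Y \<rightarrow> mspace X" using fg by auto
      fix x y assume xy: "x \<in> mspace Y" "y \<in> mspace Y"
      then have "f y \<in> mspace X" using fg by auto
      then show "mdist X (f x) (f y) = mdist Y x y" using adj[OF xy(1)] gf[OF xy(2)] by simp
    qed
    show "f ` mspace Y = mspace X"
    proof
      show "f ` mspace Y \<subseteq> mspace X" using fg by auto
      show "mspace X \<subseteq> f ` mspace Y"
      proof
        fix x assume x: "x \<in> mspace X"
        then have "g x \<in> mspace Y" using fg by auto
        then show "x \<in> f ` mspace Y" using fg'[OF x] by (metis imageI)
      qed
    qed
  qed
qed

text \<open>Uniqueness of Gromov-Hausdorff limits, with one of the two limits realised as a Hausdorff limit. If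
  \<open>U n\<close> is within \<open>\<epsilon>/4\<close> of both \<open>Y\<close> and \<open>K\<close>, then going from \<open>Y\<close> to \<open>K\<close> and back through nearby
  points of \<open>U n\<close> gives a pair of maps adjoint up to \<open>\<epsilon>\<close>.\<close>

lemma GH_limit_isometric_hausdorff_limit:
  fixes U :: "nat \<Rightarrow> 'u metric" and Y :: "'b metric" and Z :: "'z metric"
  assumes Y: "compact_metric Y" and K: "compactin (mtopology_of Z) K"
    and GH: "(\<lambda>n. GH_dist (U n) Y) \<longlonglongrightarrow> 0"
    and h: "\<forall>\<^sub>F n in sequentially. isometric_embedding (U n) Z (h n)"
    and conv: "hausdorff_converges Z (\<lambda>n. h n ` mspace (U n)) K"
  obtains f where "isometric_embedding Y Z f" "f ` mspace Y = K"
proof -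
  define X where "X = submetric Z K"
  have KZ: "K \<subseteq> mspace Z" using compactin_subset_topspace[OF K] by simp
  have X: "mspace X = K" "mdist X = mdist Z" using KZ by (auto simp: X_def)
  have "compact_metric X"
    unfolding X_def mtopology_of_submetric using K by (rule compact_space_subtopology)
  moreover have "\<exists>f g. f \<in> mspace Y \<rightarrow> mspace X \<and> g \<in> mspace X \<rightarrow> mspace Y \<and>
       (\<forall>y\<in>mspace Y. \<forall>x\<in>mspace X. \<bar>mdist X (f y) x - mdist Y y (g x)\<bar> \<le> \<epsilon>)" if "0 < \<epsilon>" for \<epsilon>
  proof -
    have e4: "0 < \<epsilon>/4" using that by simp
    have "\<forall>\<^sub>F n in sequentially. GH_dist (U n) Y < ennreal (\<epsilon>/4)"
      using GH e4 unfolding ennreal_tendsto_0_iff by blast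
    moreover have "\<forall>\<^sub>F n in sequentially. hausdorff_close Z (\<epsilon>/4) (h n ` mspace (U n)) K"
      using conv e4 unfolding hausdorff_converges_iff by blast
    ultimately have "\<forall>\<^sub>F n in sequentially. GH_dist (U n) Y < ennreal (\<epsilon>/4) \<and>
        hausdorff_close Z (\<epsilon>/4) (h n ` mspace (U n)) K \<and> isometric_embedding (U n) Z (h n)"
      using h by eventually_elim simp
    then obtain n where n: "GH_dist (U n) Y < ennreal (\<epsilon>/4)"
        "hausdorff_close Z (\<epsilon>/4) (h n ` mspace (U n)) K" "isometric_embedding (U n) Z (h n)"
      using eventually_happens'[OF sequentially_bot] by blast
    obtain W :: "('u + 'b) metric" and p q where W: "isometric_embedding (U n) W p"
        "isometric_embedding Y W q" "hausdorff_close W (\<epsilon>/4) (p ` mspace (U n)) (q ` mspace Y)"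
      using GH_dist_lessD[OF n(1)] .
    define near where "near y x u \<longleftrightarrow> y \<in> mspace Y \<and> x \<in> K \<and> u \<in> mspace (U n) \<and>
        mdist W (p u) (q y) \<le> \<epsilon>/4 \<and> mdist Z (h n u) x \<le> \<epsilon>/4" for y x u
    have "\<exists>x u. near y x u" if y: "y \<in> mspace Y" for y
    proof -
      obtain u where u: "u \<in> mspace (U n)" "mdist W (p u) (q y) \<le> \<epsilon>/4"
        using W(3) y unfolding hausdorff_close_def by auto
      moreover obtain x where "x \<in> K" "mdist Z (h n u) x \<le> \<epsilon>/4"
        using n(2) u(1) unfolding hausdorff_close_def by auto
      ultimately show ?thesis using y unfolding near_def by blast
    qed
    then have "\<forall>y\<in>mspace Y. \<exists>xu. near y (fst xu) (snd xu)" by auto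
    then obtain f where f: "\<forall>y\<in>mspace Y. near y (fst (f y)) (snd (f y))" by (rule bchoice[THEN exE])
    have "\<exists>y u. near y x u" if x: "x \<in> K" for x
    proof -
      obtain u where u: "u \<in> mspace (U n)" "mdist Z (h n u) x \<le> \<epsilon>/4"
        using n(2) x unfolding hausdorff_close_def by auto
      moreover obtain y where "y \<in> mspace Y" "mdist W (p u) (q y) \<le> \<epsilon>/4"
        using W(3) u(1) unfolding hausdorff_close_def by auto
      ultimately show ?thesis using x unfolding near_def by blast
    qed
    then have "\<forall>x\<in>K. \<exists>yu. near (fst yu) x (snd yu)" by auto
    then obtain g where g: "\<forall>x\<in>K. near (fst (g x)) x (snd (g x))" by (rule bchoice[THEN exE])
    have *: "\<bar>mdist Z x x' - mdist Y y y'\<bar> \<le> \<epsilon>" if "near y x u" "near y' x' u'" for y x u y' x' u'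
    proof -
      note nr = that[unfolded near_def]
      have "\<bar>mdist Z x x' - mdist Z (h n u) (h n u')\<bar> \<le> mdist Z x (h n u) + mdist Z x' (h n u')"
        using nr KZ isometric_embeddingD(1)[OF n(3)] by (intro mdist_quadrilateral) auto
      moreover have "\<bar>mdist W (q y) (q y') - mdist W (p u) (p u')\<bar> \<le> mdist W (q y) (p u) + mdist W (q y') (p u')"
        using nr isometric_embeddingD(1)[OF W(1)] isometric_embeddingD(1)[OF W(2)]
        by (intro mdist_quadrilateral) auto
      moreover have "mdist Z (h n u) (h n u') = mdist W (p u) (p u')"
        using nr isometric_embeddingD(2)[OF W(1)] isometric_embeddingD(2)[OF n(3)] by simp
      moreover have "mdist W (q y) (q y') = mdist Y y y'"
        using nr isometric_embeddingD(2)[OF W(2)] by simp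
      moreover have "mdist Z x (h n u) \<le> \<epsilon>/4" "mdist Z x' (h n u') \<le> \<epsilon>/4"
          "mdist W (q y) (p u) \<le> \<epsilon>/4" "mdist W (q y') (p u') \<le> \<epsilon>/4"
        using nr by (simp_all add: mdist_commute[of Z x] mdist_commute[of Z x'] mdist_commute[of W "q _"])
      ultimately show ?thesis by linarith
    qed
    have "(fst \<circ> f) \<in> mspace Y \<rightarrow> mspace X" using f by (auto simp: near_def X)
    moreover have "(fst \<circ> g) \<in> mspace X \<rightarrow> mspace Y" using g by (auto simp: near_def X)
    moreover have "\<bar>mdist X ((fst \<circ> f) y) x - mdist Y y ((fst \<circ> g) x)\<bar> \<le> \<epsilon>"
      if "y \<in> mspace Y" "x \<in> mspace X" for x y
      using *[of y "fst (f y)" "snd (f y)" "fst (g x)" x "snd (g x)"] f g that by (simp add: X)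
    ultimately show ?thesis by blast
  qed
  ultimately obtain f where f: "isometric_embedding Y X f" "f ` mspace Y = mspace X"
    using compact_metric_isometry_of_adjoint_approximations[of X Y] Y by blast
  show ?thesis
  proof (rule that)
    show "f ` mspace Y = K" using f X by simp
    show "isometric_embedding Y Z f"
      using f(1) KZ by (auto simp: isometric_embedding_def X)
  qed
qed

section \<open>Gluing a sequence of spaces to its limit\<close>

text \<open>The upper bound carries no error term: gluing below needs maps that do not increase distances at
  all, while they may decrease them by up to \<open>2 * \<epsilon>\<close>.\<close>

definition nearly_isometric :: "'a metric \<Rightarrow> 'e metric \<Rightarrow> real \<Rightarrow> ('a \<Rightarrow> 'e) \<Rightarrow> bool" where
  "nearly_isometric X E \<epsilon> V \<longleftrightarrow> V \<in> mspace X \<rightarrow> mspace E \<and>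
     (\<forall>x\<in>mspace X. \<forall>x'\<in>mspace X. mdist E (V x) (V x') \<le> mdist X x x' \<and>
                                   mdist X x x' \<le> mdist E (V x) (V x') + 2 * \<epsilon>)"

lemma nearly_isometricD:
  assumes "nearly_isometric X E \<epsilon> V"
  shows "x \<in> mspace X \<Longrightarrow> V x \<in> mspace E"
    and "x \<in> mspace X \<Longrightarrow> x' \<in> mspace X \<Longrightarrow> mdist E (V x) (V x') \<le> mdist X x x'"
    and "x \<in> mspace X \<Longrightarrow> x' \<in> mspace X \<Longrightarrow> mdist X x x' \<le> mdist E (V x) (V x') + 2 * \<epsilon>"
  using assms by (auto simp: nearly_isometric_def)

lemma nearly_isometric_pushforward:
  assumes "nearly_isometric X E \<epsilon> (V \<circ> f)" "inj_on f (mspace X)"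
  shows "nearly_isometric (pushforward f X) E \<epsilon> V"
  using assms(1) isometric_embeddingD(2)[OF pushforward_isometric[OF assms(2)]]
  by (auto simp: nearly_isometric_def mspace_pushforward[OF assms(2)])

text \<open>A distance on the disjoint union of the \<open>A k\<close>. Different components are compared through their
  images under V in the common space E; the additive constants \<open>e k\<close> repay the loss of distance
  under V, as a detour from \<open>A i\<close> through another component passes the constant \<open>e i\<close> twice.\<close>

definition glue_dist ::
  "(nat \<Rightarrow> 'p metric) \<Rightarrow> 'e metric \<Rightarrow> (nat \<Rightarrow> real) \<Rightarrow> (nat \<Rightarrow> 'p \<Rightarrow> 'e) \<Rightarrow> nat \<times> 'p \<Rightarrow> nat \<times> 'p \<Rightarrow> real" where
  "glue_dist A E e V p q =
     (if fst p = fst q then mdist (A (fst p)) (snd p) (snd q)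
      else mdist E (V (fst p) (snd p)) (V (fst q) (snd q)) + e (fst p) + e (fst q))"

text \<open>Component 0 is the limit space and has constant 0; all other constants are positive, which
  separates the points of different components. In the triangle inequality the critical case is
  \<open>i = k \<noteq> j\<close>, where near-isometry and the constants enter.\<close>

lemma Metric_space_glue:
  assumes V: "\<And>k. nearly_isometric (A k) E (e k) (V k)" and e0: "e 0 = 0" and epos: "\<And>k. 0 < e (Suc k)"
  shows "Metric_space (SIGMA k:UNIV. mspace (A k)) (glue_dist A E e V)"
proof
  have e: "0 \<le> e k" for k using e0 epos[of "k - 1"] by (cases k) auto
  \<comment> \<open>At most one of two different components is component 0.\<close>
  have e': "0 < e i + e j" if "i \<noteq> j" for i j
    using that e0 epos[of "i - 1"] epos[of "j - 1"] by (cases i; cases j) (auto intro: add_pos_pos)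
  fix p q r :: "nat \<times> 'a"
  obtain i x where p: "p = (i, x)" by fastforce
  obtain j y where q: "q = (j, y)" by fastforce
  obtain k z where r: "r = (k, z)" by fastforce
  show "0 \<le> glue_dist A E e V p q" using e by (simp add: glue_dist_def)
  show "glue_dist A E e V p q = glue_dist A E e V q p" by (simp add: glue_dist_def mdist_commute)
  assume pM: "p \<in> (SIGMA k:UNIV. mspace (A k))" and qM: "q \<in> (SIGMA k:UNIV. mspace (A k))"
  then have x: "x \<in> mspace (A i)" and y: "y \<in> mspace (A j)" by (auto simp: p q)
  show "glue_dist A E e V p q = 0 \<longleftrightarrow> p = q"
  proof (cases "i = j")
    case True
    then show ?thesis using x y by (simp add: glue_dist_def p q)
  next
    case False
    have "0 < mdist E (V i x) (V j y) + e i + e j"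
      using e'[OF False] mdist_nonneg[of E "V i x" "V j y"] by linarith
    then show ?thesis using False by (simp add: glue_dist_def p q)
  qed
  assume "r \<in> (SIGMA k:UNIV. mspace (A k))"
  then have z: "z \<in> mspace (A k)" by (auto simp: r)
  note VE = nearly_isometricD(1)[OF V x] nearly_isometricD(1)[OF V y] nearly_isometricD(1)[OF V z]
  have tri: "mdist E (V i x) (V k z) \<le> mdist E (V i x) (V j y) + mdist E (V j y) (V k z)"
    using VE by (intro mdist_triangle)
  consider "i = j" "j = k" | "i = j" "j \<noteq> k" | "i \<noteq> j" "j = k" | "i = k" "i \<noteq> j" | "i \<noteq> j" "j \<noteq> k" "i \<noteq> k"
    by blast
  then show "glue_dist A E e V p r \<le> glue_dist A E e V p q + glue_dist A E e V q r"
  proof cases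
    case 1
    then show ?thesis using x y z by (auto simp: glue_dist_def p q r intro: mdist_triangle)
  next
    case 2
    then have "mdist E (V i x) (V j y) \<le> mdist (A i) x y" using nearly_isometricD(2)[OF V x] y by simp
    then show ?thesis using 2 tri by (auto simp: glue_dist_def p q r)
  next
    case 3
    then have "mdist E (V j y) (V k z) \<le> mdist (A j) y z" using nearly_isometricD(2)[OF V y] z by simp
    then show ?thesis using 3 tri by (auto simp: glue_dist_def p q r)
  next
    case 4
    then have "mdist (A i) x z \<le> mdist E (V i x) (V k z) + 2 * e i" using nearly_isometricD(3)[OF V x] z by simp
    then show ?thesis using 4 tri e[of j] by (auto simp: glue_dist_def p q r)
  next
    case 5
    then show ?thesis using tri e[of j] by (auto simp: glue_dist_def p q r)
  qed
qed

lemma exists_almost_minimizer: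
  fixes f :: "'a \<Rightarrow> real"
  assumes "B \<noteq> {}" "\<And>b. b \<in> B \<Longrightarrow> 0 \<le> f b" "0 < \<epsilon>"
  shows "\<exists>b. b \<in> B \<and> (\<forall>b'\<in>B. f b \<le> f b' + \<epsilon>)"
proof -
  have bdd: "bdd_below (f ` B)" using assms(2) by (intro bdd_belowI2[of _ 0]) auto
  have "Inf (f ` B) < Inf (f ` B) + \<epsilon>" using assms(3) by simp
  then obtain b where b: "b \<in> B" "f b < Inf (f ` B) + \<epsilon>"
    using cInf_lessD[of "f ` B"] assms(1) by blast
  show ?thesis
  proof (intro exI[of _ b] conjI ballI b(1))
    fix b' assume "b' \<in> B"
    then have "Inf (f ` B) \<le> f b'" by (intro cINF_lower bdd)
    then show "f b \<le> f b' + \<epsilon>" using b by simp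
  qed
qed

text \<open>A sequence in the glued space either returns infinitely often to one compact component, or leaves
  every finite union of components. In the second case its distance to component 0 tends to 0, so
  that it can be compared with a sequence in that component.\<close>

lemma compact_glued_space:
  fixes A :: "nat \<Rightarrow> 'p metric" and E :: "'e metric"
  assumes A: "\<And>k. compact_metric (A k)"
    and V: "\<And>k. nearly_isometric (A k) E (e k) (V k)" and e0: "e 0 = 0" and epos: "\<And>k. 0 < e (Suc k)"
    and conv: "\<And>\<epsilon>. 0 < \<epsilon> \<Longrightarrow> \<forall>\<^sub>F k in sequentially. e k \<le> \<epsilon> \<and>
                 hausdorff_close E \<epsilon> (V k ` mspace (A k)) (V 0 ` mspace (A 0))"
  obtains W :: "(nat \<times> 'p) metric" where "compact_metric W" "\<And>k. isometric_embedding (A k) W (Pair k)"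
    "hausdorff_converges W (\<lambda>k. Pair k ` mspace (A k)) (Pair 0 ` mspace (A 0))"
proof -
  define W where "W = metric (SIGMA k:UNIV. mspace (A k), glue_dist A E e V)"
  note M = Metric_space_glue[of A E e V, OF V e0 epos]
  have mW: "mspace W = (SIGMA k:UNIV. mspace (A k))" unfolding W_def by (rule Metric_space.mspace_metric[OF M])
  have dW: "mdist W = glue_dist A E e V" unfolding W_def by (rule Metric_space.mdist_metric[OF M])
  have iso: "isometric_embedding (A k) W (Pair k)" for k
    by (auto simp: isometric_embedding_def mW dW glue_dist_def)
  have close: "\<forall>\<^sub>F k in sequentially. hausdorff_close W \<epsilon> (Pair k ` mspace (A k)) (Pair 0 ` mspace (A 0))"
    if \<epsilon>: "0 < \<epsilon>" for \<epsilon>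
  proof -
    have "\<forall>\<^sub>F k in sequentially. e k \<le> \<epsilon>/2 \<and>
        hausdorff_close E (\<epsilon>/2) (V k ` mspace (A k)) (V 0 ` mspace (A 0))" using \<epsilon> by (intro conv) simp
    then show ?thesis using eventually_gt_at_top[of 0]
    proof eventually_elim
      case (elim k)
      have "mdist W (k, x) (0, y) \<le> \<epsilon>" if "mdist E (V k x) (V 0 y) \<le> \<epsilon>/2" for x y
        using that elim e0 unfolding dW glue_dist_def by simp
      then show ?case
        using elim unfolding hausdorff_close_def by simp blast
    qed
  qed
  have "compact_metric W"
    unfolding compact_metric_sequentially
  proof (intro allI impI)
    fix \<sigma> :: "nat \<Rightarrow> nat \<times> 'p" assume "range \<sigma> \<subseteq> mspace W"
    then have "\<sigma> n \<in> mspace W" for n by auto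
    then have \<sigma>: "snd (\<sigma> n) \<in> mspace (A (fst (\<sigma> n)))" for n by (metis SigmaE mW snd_conv fst_conv)
    show "\<exists>l\<in>mspace W. \<exists>r::nat\<Rightarrow>nat. strict_mono r \<and> (\<lambda>n. mdist W (\<sigma> (r n)) l) \<longlonglongrightarrow> 0"
    proof (cases "\<exists>k. infinite {n. fst (\<sigma> n) = k}")
      case True
      then obtain k where k: "infinite {n. fst (\<sigma> n) = k}" by blast
      define s where "s = enumerate {n. fst (\<sigma> n) = k}"
      have s: "strict_mono s" unfolding s_def using k by (rule strict_mono_enumerate)
      have sk: "fst (\<sigma> (s n)) = k" for n unfolding s_def using enumerate_in_set[OF k] by blast
      have "snd (\<sigma> (s n)) \<in> mspace (A k)" for n using \<sigma>[of "s n"] sk by simp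
      from compact_metric_subsequence[OF A this]
      obtain l r where l: "l \<in> mspace (A k)" "strict_mono (r::nat\<Rightarrow>nat)"
          "(\<lambda>n. mdist (A k) (snd (\<sigma> (s (r n)))) l) \<longlonglongrightarrow> 0" .
      have "(\<lambda>n. mdist W (\<sigma> ((s \<circ> r) n)) (k, l)) \<longlonglongrightarrow> 0"
        using l(3) by (simp add: dW glue_dist_def sk)
      moreover have "(k, l) \<in> mspace W" using l(1) by (simp add: mW)
      moreover have "strict_mono (s \<circ> r)" using s l(2) by (rule strict_mono_o)
      ultimately show ?thesis by blast
    next
      case False
      have far: "\<forall>\<^sub>F n in sequentially. N \<le> fst (\<sigma> n)" for N
      proof -
        have "finite (\<Union>k<N. {n. fst (\<sigma> n) = k})" using False by simp
        then have "finite {n. \<not> N \<le> fst (\<sigma> n)}" by (rule finite_subset[rotated]) auto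
        then show ?thesis by (simp add: eventually_cofinite flip: cofinite_eq_sequentially)
      qed
      have near: "\<forall>\<^sub>F n in sequentially. \<exists>y\<in>mspace (A 0). mdist W (\<sigma> n) (0, y) \<le> \<epsilon>" if \<epsilon>: "0 < \<epsilon>" for \<epsilon>
      proof -
        obtain N where N: "\<And>k. N \<le> k \<Longrightarrow> hausdorff_close W \<epsilon> (Pair k ` mspace (A k)) (Pair 0 ` mspace (A 0))"
          using close[OF \<epsilon>] unfolding eventually_sequentially by blast
        show ?thesis
        proof (rule eventually_mono[OF far[of N]])
          fix n assume "N \<le> fst (\<sigma> n)"
          from N[OF this] \<sigma>[of n] have "\<exists>y\<in>mspace (A 0). mdist W (fst (\<sigma> n), snd (\<sigma> n)) (0, y) \<le> \<epsilon>"
            unfolding hausdorff_close_def by blast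
          then show "\<exists>y\<in>mspace (A 0). mdist W (\<sigma> n) (0, y) \<le> \<epsilon>" by simp
        qed
      qed
      \<comment> \<open>A nearest point need not be chosen: one that is nearest up to \<open>1/(n+1)\<close> suffices.\<close>
      have "mspace (A 0) \<noteq> {}"
        using eventually_happens'[OF sequentially_bot near[OF zero_less_one]] by blast
      then have "\<forall>n. \<exists>y. y \<in> mspace (A 0) \<and>
          (\<forall>y'\<in>mspace (A 0). mdist W (\<sigma> n) (0, y) \<le> mdist W (\<sigma> n) (0, y') + inverse (real (Suc n)))"
        by (intro allI exists_almost_minimizer) simp_all
      then obtain y where "\<forall>n. y n \<in> mspace (A 0) \<and>
          (\<forall>y'\<in>mspace (A 0). mdist W (\<sigma> n) (0, y n) \<le> mdist W (\<sigma> n) (0, y') + inverse (real (Suc n)))"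
        by (rule choice[THEN exE])
      then have y: "\<And>n. y n \<in> mspace (A 0)" "\<And>n y'. y' \<in> mspace (A 0) \<Longrightarrow>
          mdist W (\<sigma> n) (0, y n) \<le> mdist W (\<sigma> n) (0, y') + inverse (real (Suc n))" by auto
      have lim: "(\<lambda>n. mdist W (\<sigma> n) (0, y n)) \<longlonglongrightarrow> 0"
      proof (rule order_tendstoI)
        fix a :: real assume "a < 0"
        then show "\<forall>\<^sub>F n in sequentially. a < mdist W (\<sigma> n) (0, y n)"
          by (intro always_eventually allI) (meson less_le_trans mdist_nonneg)
      next
        fix a :: real assume a: "0 < a"
        then have "\<forall>\<^sub>F n in sequentially. inverse (real (Suc n)) < a/2"
          by (intro order_tendstoD(2)[OF LIMSEQ_inverse_real_of_nat]) simp
        moreover have "\<forall>\<^sub>F n in sequentially. \<exists>y\<in>mspace (A 0). mdist W (\<sigma> n) (0, y) \<le> a/2"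
          using near[of "a/2"] a by simp
        ultimately show "\<forall>\<^sub>F n in sequentially. mdist W (\<sigma> n) (0, y n) < a"
        proof eventually_elim
          case (elim n)
          then obtain y' where "y' \<in> mspace (A 0)" "mdist W (\<sigma> n) (0, y') \<le> a/2" by blast
          with y(2)[of y' n] elim(1) show ?case by linarith
        qed
      qed
      obtain l r where l: "l \<in> mspace (A 0)" "strict_mono (r::nat\<Rightarrow>nat)"
          "(\<lambda>n. mdist (A 0) (y (r n)) l) \<longlonglongrightarrow> 0"
        using compact_metric_subsequence[OF A y(1)] .
      have bound: "mdist W (\<sigma> (r n)) (0, l) \<le> mdist W (\<sigma> (r n)) (0, y (r n)) + mdist (A 0) (y (r n)) l" for n
      proof -
        have "\<sigma> (r n) \<in> mspace W" using \<sigma>[of "r n"] by (metis SigmaI UNIV_I mW prod.collapse)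
        moreover have "(0, y (r n)) \<in> mspace W" "(0, l) \<in> mspace W" using y l by (simp_all add: mW)
        ultimately have "mdist W (\<sigma> (r n)) (0, l) \<le> mdist W (\<sigma> (r n)) (0, y (r n)) + mdist W (0, y (r n)) (0, l)"
          by (rule mdist_triangle)
        then show ?thesis by (simp add: dW glue_dist_def)
      qed
      have "(\<lambda>n. mdist W (\<sigma> (r n)) (0, y (r n))) \<longlonglongrightarrow> 0"
        using LIMSEQ_subseq_LIMSEQ[OF lim l(2)] by (simp add: o_def)
      from tendsto_add[OF this l(3)]
      have sum: "(\<lambda>n. mdist W (\<sigma> (r n)) (0, y (r n)) + mdist (A 0) (y (r n)) l) \<longlonglongrightarrow> 0" by simp
      have "(\<lambda>n. mdist W (\<sigma> (r n)) (0, l)) \<longlonglongrightarrow> 0"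
        by (rule Lim_null_comparison[OF _ sum]) (use bound in simp)
      moreover have "(0, l) \<in> mspace W" using l(1) by (simp add: mW)
      ultimately show ?thesis using l(2) by blast
    qed
  qed
  moreover have "hausdorff_converges W (\<lambda>k. Pair k ` mspace (A k)) (Pair 0 ` mspace (A 0))"
    unfolding hausdorff_converges_iff using close by blast
  ultimately show ?thesis using that iso by blast
qed

section \<open>A common compact space for a Gromov-Hausdorff convergent sequence\<close>

lemma hausdorff_close_isometric_image:
  assumes c: "isometric_embedding W Z c" and "A \<subseteq> mspace W" "B \<subseteq> mspace W"
  shows "hausdorff_close Z \<epsilon> (c ` A) (c ` B) \<longleftrightarrow> hausdorff_close W \<epsilon> A B"
proof -
  have "mdist Z (c a) (c b) = mdist W a b" if "a \<in> A" "b \<in> B" for a b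
    using isometric_embeddingD(2)[OF c] assms that by blast
  then show ?thesis unfolding hausdorff_close_def by (simp cong: ball_cong bex_cong)
qed

lemma compact_metric_bounded:
  assumes "compact_metric X"
  obtains B where "0 < B" "\<And>x y. x \<in> mspace X \<Longrightarrow> y \<in> mspace X \<Longrightarrow> mdist X x y \<le> B"
proof -
  interpret Metric_space "mspace X" "mdist X" by simp
  have "mbounded (mspace X)"
    using assms by (intro compactin_imp_mbounded) (simp add: compact_space_def mtopology_of_def)
  then show ?thesis using that unfolding mbounded_alt_pos by blast
qed

text \<open>The comparison space for gluing: bounded functions on the limit space with the supremum distance.\<close>

abbreviation bounded_funs :: "'b metric \<Rightarrow> ('b \<Rightarrow> real) metric" where
  "bounded_funs Y \<equiv> funspace (mspace Y) euclidean_metric"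

lemma mem_bounded_funs:
  "u \<in> mspace (bounded_funs Y) \<longleftrightarrow> u \<in> extensional (mspace Y) \<and> bounded (u ` mspace Y)"
  by (simp add: Met_TC.fspace_def)

lemma mdist_bounded_funs_le:
  assumes "0 \<le> c" "\<And>y. y \<in> mspace Y \<Longrightarrow> \<bar>u y - v y\<bar> \<le> c"
  shows "mdist (bounded_funs Y) u v \<le> c"
  using assms by (auto simp: Met_TC.fdist_def dist_real_def intro!: cSUP_least)

lemma le_mdist_bounded_funs:
  assumes "u \<in> mspace (bounded_funs Y)" "v \<in> mspace (bounded_funs Y)" "y \<in> mspace Y"
  shows "\<bar>u y - v y\<bar> \<le> mdist (bounded_funs Y) u v"
proof -
  have ne: "mspace Y \<noteq> {}" using assms(3) by blast
  have *: "u \<in> Met_TC.fspace (mspace Y)" "v \<in> Met_TC.fspace (mspace Y)" using assms by simp_all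
  from Met_TC.bdd_above_dist[OF * ne] assms(3)
  have "dist (u y) (v y) \<le> (SUP y\<in>mspace Y. dist (u y) (v y))" by (intro cSUP_upper)
  then show ?thesis using * ne by (simp add: Met_TC.fdist_def dist_real_def)
qed

definition kuratowski :: "'b metric \<Rightarrow> 'b \<Rightarrow> 'b \<Rightarrow> real" where
  "kuratowski Y y = (\<lambda>z\<in>mspace Y. mdist Y y z)"

text \<open>If X and Y lie in Z at Hausdorff distance at most \<open>\<epsilon>\<close>, a point of X is recorded by its distances
  to the points of Y. This does not increase distances by the triangle inequality, and loses at most
  \<open>2 * \<epsilon>\<close> since every point of X has a point of Y within \<open>\<epsilon>\<close>. Nearby points of X and Y have
  nearby distance functions, so the images remain close.\<close>

lemma nearly_isometric_of_hausdorff_close: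
  assumes Y: "compact_metric Y"
    and f: "isometric_embedding X Z f" and g: "isometric_embedding Y Z g"
    and close: "hausdorff_close Z \<epsilon> (f ` mspace X) (g ` mspace Y)"
  defines "V \<equiv> \<lambda>x. \<lambda>y\<in>mspace Y. mdist Z (f x) (g y)"
  shows "nearly_isometric X (bounded_funs Y) \<epsilon> V"
    and "hausdorff_close (bounded_funs Y) \<epsilon> (V ` mspace X) (kuratowski Y ` mspace Y)"
proof -
  note fD = isometric_embeddingD[OF f] and gD = isometric_embeddingD[OF g]
  obtain B where B: "0 < B" "\<And>x y. x \<in> mspace Y \<Longrightarrow> y \<in> mspace Y \<Longrightarrow> mdist Y x y \<le> B"
    using compact_metric_bounded[OF Y] by blast
  have near: "\<exists>y\<in>mspace Y. mdist Z (f x) (g y) \<le> \<epsilon>" if "x \<in> mspace X" for x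
    using close that unfolding hausdorff_close_def by blast
  have VE: "V x \<in> mspace (bounded_funs Y)" if x: "x \<in> mspace X" for x
  proof -
    obtain y where y: "y \<in> mspace Y" "mdist Z (f x) (g y) \<le> \<epsilon>" using near[OF x] by blast
    have "norm (V x z) \<le> \<epsilon> + B" if z: "z \<in> mspace Y" for z
      using mdist_triangle[of "f x" Z "g y" "g z"] fD gD x y B(2)[OF y(1) z] z by (simp add: V_def)
    then have "bounded (V x ` mspace Y)" by (intro boundedI) auto
    then show ?thesis unfolding mem_bounded_funs by (simp add: V_def)
  qed
  show "nearly_isometric X (bounded_funs Y) \<epsilon> V"
    unfolding nearly_isometric_def
  proof (intro conjI ballI)
    show "V \<in> mspace X \<rightarrow> mspace (bounded_funs Y)" using VE by blast
    fix x x' assume x: "x \<in> mspace X" and x': "x' \<in> mspace X"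
    show "mdist (bounded_funs Y) (V x) (V x') \<le> mdist X x x'"
    proof (rule mdist_bounded_funs_le)
      fix y assume y: "y \<in> mspace Y"
      have "\<bar>mdist Z (f x) (g y) - mdist Z (f x') (g y)\<bar> \<le> mdist Z (f x) (f x') + mdist Z (g y) (g y)"
        using x x' y fD gD by (intro mdist_quadrilateral) auto
      then show "\<bar>V x y - V x' y\<bar> \<le> mdist X x x'" using x x' y fD gD by (simp add: V_def)
    qed simp
    obtain y where y: "y \<in> mspace Y" "mdist Z (f x) (g y) \<le> \<epsilon>" using near[OF x] by blast
    have "mdist X x x' \<le> mdist Z (f x) (g y) + mdist Z (g y) (f x')"
      using mdist_triangle[of "f x" Z "g y" "f x'"] x x' y fD gD by simp
    also have "\<dots> \<le> \<epsilon> + V x' y" using y mdist_commute[of Z "g y"] by (simp add: V_def)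
    also have "\<dots> \<le> \<bar>V x y - V x' y\<bar> + 2 * \<epsilon>" using y by (simp add: V_def)
    also have "\<dots> \<le> mdist (bounded_funs Y) (V x) (V x') + 2 * \<epsilon>"
      using le_mdist_bounded_funs[OF VE[OF x] VE[OF x'] y(1)] by simp
    finally show "mdist X x x' \<le> mdist (bounded_funs Y) (V x) (V x') + 2 * \<epsilon>" .
  qed
  have close': "mdist (bounded_funs Y) (V x) (kuratowski Y y) \<le> \<epsilon>"
    if x: "x \<in> mspace X" and y: "y \<in> mspace Y" and xy: "mdist Z (f x) (g y) \<le> \<epsilon>" for x y
  proof (rule mdist_bounded_funs_le)
    show "0 \<le> \<epsilon>" using xy mdist_nonneg[of Z "f x" "g y"] by linarith
    fix z assume z: "z \<in> mspace Y"
    have "\<bar>mdist Z (f x) (g z) - mdist Z (g y) (g z)\<bar> \<le> mdist Z (f x) (g y) + mdist Z (g z) (g z)"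
      using x y z fD gD by (intro mdist_quadrilateral) auto
    then show "\<bar>V x z - kuratowski Y y z\<bar> \<le> \<epsilon>"
      using x y z xy fD gD by (simp add: V_def kuratowski_def)
  qed
  show "hausdorff_close (bounded_funs Y) \<epsilon> (V ` mspace X) (kuratowski Y ` mspace Y)"
    unfolding hausdorff_close_def
  proof (intro conjI ballI)
    fix v assume "v \<in> V ` mspace X"
    then obtain x where x: "x \<in> mspace X" "v = V x" by blast
    obtain y where y: "y \<in> mspace Y" "mdist Z (f x) (g y) \<le> \<epsilon>" using near[OF x(1)] by blast
    then show "\<exists>k\<in>kuratowski Y ` mspace Y. mdist (bounded_funs Y) v k \<le> \<epsilon>"
      using close'[OF x(1) y] x(2) by blast
  next
    fix k assume "k \<in> kuratowski Y ` mspace Y"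
    then obtain y where y: "y \<in> mspace Y" "k = kuratowski Y y" by blast
    obtain x where x: "x \<in> mspace X" "mdist Z (f x) (g y) \<le> \<epsilon>"
      using close y(1) unfolding hausdorff_close_def by blast
    then show "\<exists>v\<in>V ` mspace X. mdist (bounded_funs Y) v k \<le> \<epsilon>"
      using close'[OF x(1) y(1) x(2)] y(2) by blast
  qed
qed

lemma kuratowski_nearly_isometric:
  assumes "compact_metric Y"
  shows "nearly_isometric Y (bounded_funs Y) 0 (kuratowski Y)"
proof -
  have id: "isometric_embedding Y Y (\<lambda>y. y)" by (simp add: isometric_embedding_def)
  have "hausdorff_close Y 0 ((\<lambda>y. y) ` mspace Y) ((\<lambda>y. y) ` mspace Y)"
    unfolding hausdorff_close_def by (auto intro!: bexI)
  from nearly_isometric_of_hausdorff_close(1)[OF assms id id this]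
  show ?thesis by (simp add: kuratowski_def[abs_def])
qed

text \<open>A bounded space is nearly isometric to a point, with a large error. This serves the finitely many
  spaces that may be at infinite Gromov-Hausdorff distance from the limit.\<close>

lemma compact_metric_nearly_isometric_const:
  assumes "compact_metric X"
  obtains V e where "0 < e" "nearly_isometric X (bounded_funs Y) e V"
proof -
  obtain B where B: "0 < B" "\<And>x y. x \<in> mspace X \<Longrightarrow> y \<in> mspace X \<Longrightarrow> mdist X x y \<le> B"
    using compact_metric_bounded[OF assms] by blast
  define u :: "'b \<Rightarrow> real" where "u = (\<lambda>y\<in>mspace Y. 0)"
  have u: "u \<in> mspace (bounded_funs Y)"
    unfolding mem_bounded_funs by (auto simp: u_def intro!: boundedI[of _ 0])
  then have "mdist (bounded_funs Y) u u = 0" by (rule mdist_self)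
  moreover have "mdist X x y \<le> 2 * B" if "x \<in> mspace X" "y \<in> mspace X" for x y
    using B(1) B(2)[OF that] by linarith
  ultimately have "nearly_isometric X (bounded_funs Y) B (\<lambda>x. u)"
    using u unfolding nearly_isometric_def by (simp del: mspace_funspace mdist_funspace)
  with B(1) show ?thesis by (rule that)
qed

text \<open>Distances to a dense sequence determine a point.\<close>

lemma compact_metric_injection_to_sequences:
  fixes X :: "'a metric"
  assumes X: "compact_metric X"
  obtains c :: "'a \<Rightarrow> nat \<Rightarrow> real" where "inj_on c (mspace X)"
proof (cases "mspace X = {}")
  case True
  then show ?thesis using that by simp
next
  case False
  obtain z :: "nat \<Rightarrow> 'a" where z: "\<And>n. z n \<in> mspace X"
    "\<And>x \<epsilon>. x \<in> mspace X \<Longrightarrow> 0 < \<epsilon> \<Longrightarrow> \<exists>n. mdist X x (z n) < \<epsilon>"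
    using compact_metric_dense_sequence[OF X False] by blast
  have "inj_on (\<lambda>x n. mdist X x (z n)) (mspace X)"
  proof (rule inj_onI, rule ccontr)
    fix x y assume x: "x \<in> mspace X" and y: "y \<in> mspace X" and "x \<noteq> y"
      and eq: "(\<lambda>n. mdist X x (z n)) = (\<lambda>n. mdist X y (z n))"
    have "mdist X x y \<noteq> 0" using x y \<open>x \<noteq> y\<close> by simp
    then have "0 < mdist X x y / 2" using mdist_nonneg[of X x y] by linarith
    then obtain n where n: "mdist X x (z n) < mdist X x y / 2" using z(2)[OF x] by blast
    have "mdist X y (z n) = mdist X x (z n)" using fun_cong[OF eq, of n] by simp
    then show False
      using n mdist_triangle[OF x z(1) y, of n] mdist_commute[of X y "z n"] by simp
  qed
  then show ?thesis by (rule that)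
qed

text \<open>All \<open>X j\<close> are glued to Y along their distance functions to Y. The error at index j is chosen almost
  as small as possible among the admissible ones, so that the errors tend to 0. Component 0 of
  the glued space is Y, and component \<open>j + 1\<close> is \<open>X j\<close>.\<close>

lemma common_compact_space_all_compact:
  fixes X :: "nat \<Rightarrow> 'a metric" and Y :: "'b metric"
  assumes X: "\<And>j. compact_metric (X j)" and Y: "compact_metric Y"
    and GH: "(\<lambda>j. GH_dist (X j) Y) \<longlonglongrightarrow> 0"
  obtains Z :: "(nat \<Rightarrow> real) metric" and \<phi> \<psi> where "compact_metric Z"
    "\<And>j. isometric_embedding (X j) Z (\<phi> j)" "isometric_embedding Y Z \<psi>"
    "hausdorff_converges Z (\<lambda>j. \<phi> j ` mspace (X j)) (\<psi> ` mspace Y)"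
proof -
  define E where "E = bounded_funs Y"
  define good where "good j \<epsilon> V \<longleftrightarrow> nearly_isometric (X j) E \<epsilon> V \<and>
      hausdorff_close E \<epsilon> (V ` mspace (X j)) (kuratowski Y ` mspace Y)" for j \<epsilon> V
  define S where "S j = {\<epsilon>. 0 < \<epsilon> \<and> (\<exists>V. good j \<epsilon> V)}" for j
  have ev: "\<forall>\<^sub>F j in sequentially. \<epsilon> \<in> S j" if \<epsilon>: "0 < \<epsilon>" for \<epsilon>
  proof -
    have "\<forall>\<^sub>F j in sequentially. GH_dist (X j) Y < ennreal \<epsilon>"
      using GH \<epsilon> unfolding ennreal_tendsto_0_iff by blast
    then show ?thesis
    proof (rule eventually_mono)
      fix j assume "GH_dist (X j) Y < ennreal \<epsilon>"
      then obtain Z :: "('a + 'b) metric" and f g where Z: "isometric_embedding (X j) Z f"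
          "isometric_embedding Y Z g" "hausdorff_close Z \<epsilon> (f ` mspace (X j)) (g ` mspace Y)"
        using GH_dist_lessD by blast
      from nearly_isometric_of_hausdorff_close[OF Y Z] show "\<epsilon> \<in> S j"
        using \<epsilon> unfolding S_def good_def E_def by blast
    qed
  qed
  have "\<exists>eV. 0 < fst eV \<and> nearly_isometric (X j) E (fst eV) (snd eV) \<and>
      (\<forall>\<epsilon>\<in>S j. fst eV \<le> \<epsilon> + inverse (real (Suc j)) \<and>
         hausdorff_close E (\<epsilon> + inverse (real (Suc j))) (snd eV ` mspace (X j)) (kuratowski Y ` mspace Y))" for j
  proof (cases "S j = {}")
    case True
    obtain V e where "0 < e" "nearly_isometric (X j) E e V"
      using compact_metric_nearly_isometric_const[OF X[of j], of Y] unfolding E_def by blast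
    then show ?thesis using True by (intro exI[of _ "(e, V)"]) simp
  next
    case False
    have "\<exists>e. e \<in> S j \<and> (\<forall>\<epsilon>\<in>S j. e \<le> \<epsilon> + inverse (real (Suc j)))"
      using False by (rule exists_almost_minimizer) (auto simp: S_def)
    then obtain e where e: "e \<in> S j" "\<And>\<epsilon>. \<epsilon> \<in> S j \<Longrightarrow> e \<le> \<epsilon> + inverse (real (Suc j))" by blast
    then obtain V where V: "0 < e" "good j e V" unfolding S_def by blast
    have "hausdorff_close E (\<epsilon> + inverse (real (Suc j))) (V ` mspace (X j)) (kuratowski Y ` mspace Y)"
      if "\<epsilon> \<in> S j" for \<epsilon>
      using V(2) e(2)[OF that] unfolding good_def by (blast intro: hausdorff_close_mono)
    then show ?thesis using V e unfolding good_def by (intro exI[of _ "(e, V)"]) simp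
  qed
  then have "\<forall>j. \<exists>eV. 0 < fst eV \<and> nearly_isometric (X j) E (fst eV) (snd eV) \<and>
      (\<forall>\<epsilon>\<in>S j. fst eV \<le> \<epsilon> + inverse (real (Suc j)) \<and>
         hausdorff_close E (\<epsilon> + inverse (real (Suc j))) (snd eV ` mspace (X j)) (kuratowski Y ` mspace Y))" ..
  then obtain eV where eV: "\<forall>j. 0 < fst (eV j) \<and> nearly_isometric (X j) E (fst (eV j)) (snd (eV j)) \<and>
      (\<forall>\<epsilon>\<in>S j. fst (eV j) \<le> \<epsilon> + inverse (real (Suc j)) \<and>
         hausdorff_close E (\<epsilon> + inverse (real (Suc j))) (snd (eV j) ` mspace (X j)) (kuratowski Y ` mspace Y))"
    by (rule choice[THEN exE])
  define e where "e = case_nat 0 (\<lambda>j. fst (eV j))"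
  define A :: "nat \<Rightarrow> ('a + 'b) metric" where
    "A = case_nat (pushforward Inr Y) (\<lambda>j. pushforward Inl (X j))"
  define V :: "nat \<Rightarrow> 'a + 'b \<Rightarrow> 'b \<Rightarrow> real" where
    "V k = case_sum (snd (eV (k - 1))) (kuratowski Y)" for k
  have A0: "mspace (A 0) = Inr ` mspace Y" and AS: "mspace (A (Suc j)) = Inl ` mspace (X j)" for j
    by (simp_all add: A_def mspace_pushforward)
  have "compact_metric (A k)" for k
    using X Y by (cases k) (simp_all add: A_def compact_metric_pushforward)
  moreover have "nearly_isometric (A k) E (e k) (V k)" for k
  proof (cases k)
    case 0
    have "V 0 \<circ> Inr = kuratowski Y" by (auto simp: V_def)
    then show ?thesis
      using nearly_isometric_pushforward[of Y E 0 "V 0" Inr] kuratowski_nearly_isometric[OF Y]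
      by (simp add: 0 A_def e_def E_def)
  next
    case (Suc j)
    have "V (Suc j) \<circ> Inl = snd (eV j)" by (auto simp: V_def)
    then show ?thesis
      using nearly_isometric_pushforward[of "X j" E "fst (eV j)" "V (Suc j)" Inl] eV
      by (simp add: Suc A_def e_def)
  qed
  moreover have "e 0 = 0" "\<And>k. 0 < e (Suc k)" using eV by (simp_all add: e_def)
  moreover have "\<forall>\<^sub>F k in sequentially. e k \<le> \<epsilon> \<and>
      hausdorff_close E \<epsilon> (V k ` mspace (A k)) (V 0 ` mspace (A 0))" if \<epsilon>: "0 < \<epsilon>" for \<epsilon>
  proof -
    have "0 < \<epsilon>/2" using \<epsilon> by simp
    then have "\<forall>\<^sub>F j in sequentially. inverse (real (Suc j)) < \<epsilon>/2"
      by (rule order_tendstoD(2)[OF LIMSEQ_inverse_real_of_nat])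
    then have "\<forall>\<^sub>F j in sequentially. e (Suc j) \<le> \<epsilon> \<and>
        hausdorff_close E \<epsilon> (V (Suc j) ` mspace (A (Suc j))) (V 0 ` mspace (A 0))"
      using ev[OF \<open>0 < \<epsilon>/2\<close>]
    proof eventually_elim
      case (elim j)
      have "e (Suc j) \<le> \<epsilon>/2 + inverse (real (Suc j))" using eV elim(2) by (simp add: e_def)
      moreover have "hausdorff_close E (\<epsilon>/2 + inverse (real (Suc j)))
          (V (Suc j) ` mspace (A (Suc j))) (V 0 ` mspace (A 0))"
        using eV elim(2) by (simp add: A0 AS V_def image_image)
      ultimately show ?case using elim(1) hausdorff_close_mono by fastforce
    qed
    then show ?thesis
      unfolding eventually_sequentially_Suc[of "\<lambda>k. e k \<le> \<epsilon> \<and>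
        hausdorff_close E \<epsilon> (V k ` mspace (A k)) (V 0 ` mspace (A 0))"] .
  qed
  ultimately obtain W :: "(nat \<times> ('a + 'b)) metric" where W: "compact_metric W"
      "\<And>k. isometric_embedding (A k) W (Pair k)"
      "hausdorff_converges W (\<lambda>k. Pair k ` mspace (A k)) (Pair 0 ` mspace (A 0))"
    using compact_glued_space[of A E e V] by blast
  obtain c :: "nat \<times> ('a + 'b) \<Rightarrow> nat \<Rightarrow> real" where c: "inj_on c (mspace W)"
    using compact_metric_injection_to_sequences[OF W(1)] .
  define Z where "Z = pushforward c W"
  note cZ = pushforward_isometric[OF c, folded Z_def]
  define \<phi> where "\<phi> j = c \<circ> (Pair (Suc j) \<circ> Inl)" for j
  define \<psi> where "\<psi> = c \<circ> (Pair 0 \<circ> Inr)"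
  have "isometric_embedding (X j) (A (Suc j)) Inl" for j
    by (simp add: A_def pushforward_isometric)
  then have \<phi>: "isometric_embedding (X j) Z (\<phi> j)" for j
    unfolding \<phi>_def by (intro isometric_embedding_compose[OF _ cZ] isometric_embedding_compose[OF _ W(2)])
  have "isometric_embedding Y (A 0) Inr"
    by (simp add: A_def pushforward_isometric)
  then have \<psi>: "isometric_embedding Y Z \<psi>"
    unfolding \<psi>_def by (intro isometric_embedding_compose[OF _ cZ] isometric_embedding_compose[OF _ W(2)])
  have "hausdorff_converges Z (\<lambda>j. \<phi> j ` mspace (X j)) (\<psi> ` mspace Y)"
    unfolding hausdorff_converges_iff
  proof (intro allI impI)
    fix \<epsilon> :: real assume "0 < \<epsilon>"
    then have "\<forall>\<^sub>F k in sequentially. hausdorff_close W \<epsilon> (Pair k ` mspace (A k)) (Pair 0 ` mspace (A 0))"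
      using W(3) unfolding hausdorff_converges_iff by blast
    then have ev: "\<forall>\<^sub>F j in sequentially. hausdorff_close W \<epsilon> (Pair (Suc j) ` mspace (A (Suc j))) (Pair 0 ` mspace (A 0))"
      unfolding eventually_sequentially_Suc[of "\<lambda>k. hausdorff_close W \<epsilon> (Pair k ` mspace (A k)) (Pair 0 ` mspace (A 0))"] .
    have sub: "Pair k ` mspace (A k) \<subseteq> mspace W" for k using isometric_embeddingD(1)[OF W(2)] by blast
    show "\<forall>\<^sub>F j in sequentially. hausdorff_close Z \<epsilon> (\<phi> j ` mspace (X j)) (\<psi> ` mspace Y)"
    proof (rule eventually_mono[OF ev])
      fix j assume "hausdorff_close W \<epsilon> (Pair (Suc j) ` mspace (A (Suc j))) (Pair 0 ` mspace (A 0))"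
      then have "hausdorff_close Z \<epsilon> (c ` Pair (Suc j) ` mspace (A (Suc j))) (c ` Pair 0 ` mspace (A 0))"
        unfolding hausdorff_close_isometric_image[OF cZ sub sub] .
      then show "hausdorff_close Z \<epsilon> (\<phi> j ` mspace (X j)) (\<psi> ` mspace Y)"
        by (simp add: A0 AS \<phi>_def \<psi>_def image_image)
    qed
  qed
  with _ \<phi> \<psi> show ?thesis
    by (rule that) (unfold Z_def compact_metric_pushforward[OF c], rule W(1))
qed

text \<open>Replacing the finitely many noncompact spaces by empty ones reduces this to compact spaces.\<close>

theorem common_compact_space:
  fixes X :: "nat \<Rightarrow> 'a metric" and Y :: "'b metric"
  assumes Y: "compact_metric Y" and GH: "GH_converges X Y"
  obtains Z :: "(nat \<Rightarrow> real) metric" and \<phi> \<psi> where "compact_metric Z"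
    "\<And>j. compact_metric (X j) \<Longrightarrow> isometric_embedding (X j) Z (\<phi> j)" "isometric_embedding Y Z \<psi>"
    "hausdorff_converges Z (\<lambda>j. \<phi> j ` mspace (X j)) (\<psi> ` mspace Y)"
proof -
  define X' where "X' j = (if compact_metric (X j) then X j else submetric (X j) {})" for j
  have ev: "\<forall>\<^sub>F j in sequentially. X' j = X j"
    using GH unfolding GH_converges_def by (auto simp: X'_def elim: eventually_mono)
  have "compact_metric (X' j)" for j
    by (simp add: X'_def mtopology_of_submetric compact_space_subtopology)
  moreover have "(\<lambda>j. GH_dist (X' j) Y) \<longlonglongrightarrow> 0"
    using GH ev unfolding GH_converges_def by (auto elim!: Lim_transform_eventually elim: eventually_mono)
  ultimately obtain Z :: "(nat \<Rightarrow> real) metric" and \<phi> \<psi> where Z: "compact_metric Z"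
    "\<And>j. isometric_embedding (X' j) Z (\<phi> j)" "isometric_embedding Y Z \<psi>"
    "hausdorff_converges Z (\<lambda>j. \<phi> j ` mspace (X' j)) (\<psi> ` mspace Y)"
    using common_compact_space_all_compact[of X' Y] Y by blast
  have "isometric_embedding (X j) Z (\<phi> j)" if "compact_metric (X j)" for j
    using Z(2)[of j] that by (simp add: X'_def)
  moreover have "hausdorff_converges Z (\<lambda>j. \<phi> j ` mspace (X j)) (\<psi> ` mspace Y)"
    unfolding hausdorff_converges_iff
  proof (intro allI impI)
    fix \<epsilon> :: real assume "0 < \<epsilon>"
    then have "\<forall>\<^sub>F j in sequentially. hausdorff_close Z \<epsilon> (\<phi> j ` mspace (X' j)) (\<psi> ` mspace Y)"
      using Z(4) unfolding hausdorff_converges_iff by blast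
    with ev show "\<forall>\<^sub>F j in sequentially. hausdorff_close Z \<epsilon> (\<phi> j ` mspace (X j)) (\<psi> ` mspace Y)"
      by eventually_elim simp
  qed
  ultimately show ?thesis by (intro that[OF Z(1) _ Z(3)])
qed

section \<open>Nested completed inner regions\<close>

lemma Cauchy_seqs_submetric:
  "\<sigma> \<in> Cauchy_seqs (submetric m S) \<longleftrightarrow> range \<sigma> \<subseteq> S \<and> \<sigma> \<in> Cauchy_seqs m"
  by (auto simp: Cauchy_seqs_iff)

lemma Cauchy_equiv_submetric_mono:
  "S \<subseteq> T \<Longrightarrow> Cauchy_equiv (submetric m S) \<subseteq> Cauchy_equiv (submetric m T)"
  by (auto simp: Cauchy_equiv_def Cauchy_seqs_submetric)

lemma Cauchy_class_in_completion:
  "\<sigma> \<in> Cauchy_seqs m \<Longrightarrow> Cauchy_equiv m `` {\<sigma>} \<in> completion_points m"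
  "\<sigma> \<in> Cauchy_seqs m \<Longrightarrow> \<sigma> \<in> Cauchy_equiv m `` {\<sigma>}"
  using equiv_class_self[OF equiv_Cauchy_equiv] by (auto simp: completion_points_def quotientI)

lemma completion_point_in_larger_class:
  assumes S: "S \<subseteq> T" and D: "D \<in> completion_points (submetric m S)" and \<sigma>: "\<sigma> \<in> D"
  shows "Cauchy_equiv (submetric m T) `` {\<sigma>} \<in> completion_points (submetric m T)"
    and "D \<subseteq> Cauchy_equiv (submetric m T) `` {\<sigma>}"
proof -
  note rep = completion_point_rep[OF D \<sigma>]
  have "\<sigma> \<in> Cauchy_seqs (submetric m T)" using rep(1) S by (auto simp: Cauchy_seqs_submetric)
  then show "Cauchy_equiv (submetric m T) `` {\<sigma>} \<in> completion_points (submetric m T)"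
    by (rule Cauchy_class_in_completion(1))
  show "D \<subseteq> Cauchy_equiv (submetric m T) `` {\<sigma>}"
    using rep(2) Cauchy_equiv_submetric_mono[OF S, of m] by blast
qed

text \<open>Both distances are the limit along the same representatives.\<close>

lemma completion_dist_submetric:
  assumes C: "C \<in> completion_points (submetric m T)" "C' \<in> completion_points (submetric m T)"
    and D: "D \<in> completion_points (submetric m S)" "D' \<in> completion_points (submetric m S)"
    and sub: "D \<subseteq> C" "D' \<subseteq> C'"
  shows "completion_dist (submetric m T) C C' = completion_dist (submetric m S) D D'"
proof -
  note \<sigma> = completion_point_SOME[OF D(1)] completion_point_SOME[OF D(2)]
  from completion_dist_tendsto[OF C sub(1)[THEN subsetD, OF \<sigma>(1)] sub(2)[THEN subsetD, OF \<sigma>(2)]]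
    completion_dist_tendsto[OF D \<sigma>]
  show ?thesis unfolding mdist_submetric by (rule LIMSEQ_unique)
qed

lemma inner_region_antimono: "\<delta>' \<le> \<delta> \<Longrightarrow> inner_region m \<delta> \<subseteq> inner_region m \<delta>'"
  by (auto simp: inner_region_def)

lemma mspace_inner_completion:
  "mspace (inner_completion m \<delta>) = completion_points (submetric m (inner_region m \<delta>))"
  by (simp add: inner_completion_def)

lemma inner_completion_in_subset: "inner_completion_in m \<delta>' \<delta> \<subseteq> mspace (inner_completion m \<delta>')"
  by (auto simp: inner_completion_in_def)

lemma inner_completion_in_self: "inner_completion_in m \<delta> \<delta> = mspace (inner_completion m \<delta>)"
  by (auto simp: inner_completion_in_def)

lemma inner_completion_in_antimono:
  assumes "\<delta>' \<le> d" "d \<le> \<delta>"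
  shows "inner_completion_in m \<delta>' \<delta> \<subseteq> inner_completion_in m \<delta>' d"
proof
  fix C assume "C \<in> inner_completion_in m \<delta>' \<delta>"
  then obtain D where C: "C \<in> completion_points (submetric m (inner_region m \<delta>'))"
      and D: "D \<in> completion_points (submetric m (inner_region m \<delta>))" "D \<subseteq> C"
    by (auto simp: inner_completion_in_def mspace_inner_completion)
  obtain \<sigma> where \<sigma>: "\<sigma> \<in> D" using completion_point_SOME[OF D(1)] by (rule that)
  note larger = completion_point_in_larger_class[OF inner_region_antimono[OF assms(2)] D(1) \<sigma>]
  have "C = Cauchy_equiv (submetric m (inner_region m \<delta>')) `` {\<sigma>}"
    using completion_point_rep(2)[OF C] \<sigma> D(2) by blast
  then have "Cauchy_equiv (submetric m (inner_region m d)) `` {\<sigma>} \<subseteq> C"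
    using Cauchy_equiv_submetric_mono[OF inner_region_antimono[OF assms(1)], of m m] by blast
  then show "C \<in> inner_completion_in m \<delta>' d"
    using C larger(1) by (auto simp: inner_completion_in_def mspace_inner_completion)
qed

text \<open>Sends a class of Cauchy sequences in the smaller region to the class in the larger region
  containing it.\<close>

lemma inner_completion_embedding:
  assumes "\<delta>' \<le> \<delta>"
  obtains \<iota> where "isometric_embedding (inner_completion m \<delta>) (inner_completion m \<delta>') \<iota>"
    "\<iota> ` mspace (inner_completion m \<delta>) = inner_completion_in m \<delta>' \<delta>"
proof -
  define S where "S = inner_region m \<delta>"
  define T where "T = inner_region m \<delta>'"
  have ST: "S \<subseteq> T" unfolding S_def T_def using assms by (rule inner_region_antimono)
  define \<iota> where "\<iota> D = Cauchy_equiv (submetric m T) `` {SOME \<sigma>. \<sigma> \<in> D}" for D :: "(nat \<Rightarrow> 'a) set"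
  have \<iota>: "\<iota> D \<in> completion_points (submetric m T)" "D \<subseteq> \<iota> D"
    if "D \<in> completion_points (submetric m S)" for D
    unfolding \<iota>_def
    by (fact completion_point_in_larger_class[OF ST that completion_point_SOME[OF that]])+
  have eq: "\<iota> D = C" if "D \<in> completion_points (submetric m S)" "C \<in> completion_points (submetric m T)" "D \<subseteq> C"
    for C D
    using completion_point_rep(2)[OF that(2), of "SOME \<sigma>. \<sigma> \<in> D"] completion_point_SOME[OF that(1)] that(3)
    unfolding \<iota>_def by blast
  have mS: "mspace (inner_completion m \<delta>) = completion_points (submetric m S)"
    and mT: "mspace (inner_completion m \<delta>') = completion_points (submetric m T)"
    by (simp_all add: mspace_inner_completion S_def T_def)
  have dS: "mdist (inner_completion m \<delta>) = completion_dist (submetric m S)"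
    and dT: "mdist (inner_completion m \<delta>') = completion_dist (submetric m T)"
    by (simp_all add: inner_completion_def S_def T_def)
  have iso: "isometric_embedding (inner_completion m \<delta>) (inner_completion m \<delta>') \<iota>"
    unfolding isometric_embedding_def mS mT dS dT
  proof (intro conjI ballI funcsetI)
    fix C D assume CD: "C \<in> completion_points (submetric m S)" "D \<in> completion_points (submetric m S)"
    show "completion_dist (submetric m T) (\<iota> C) (\<iota> D) = completion_dist (submetric m S) C D"
      by (rule completion_dist_submetric[OF \<iota>(1)[OF CD(1)] \<iota>(1)[OF CD(2)] CD \<iota>(2)[OF CD(1)] \<iota>(2)[OF CD(2)]])
  qed (rule \<iota>(1))
  have "\<iota> ` mspace (inner_completion m \<delta>) = inner_completion_in m \<delta>' \<delta>"
  proof (intro set_eqI iffI)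
    fix C assume "C \<in> \<iota> ` mspace (inner_completion m \<delta>)"
    then show "C \<in> inner_completion_in m \<delta>' \<delta>"
      unfolding inner_completion_in_def mS mT using \<iota> by auto
  next
    fix C assume "C \<in> inner_completion_in m \<delta>' \<delta>"
    then obtain D where "D \<in> completion_points (submetric m S)" "C \<in> completion_points (submetric m T)" "D \<subseteq> C"
      unfolding inner_completion_in_def mS mT by auto
    then show "C \<in> \<iota> ` mspace (inner_completion m \<delta>)" unfolding mS using eq by (metis imageI)
  qed
  with iso show ?thesis by (rule that)
qed

text \<open>Completeness of a completion, in the form that the completion of S is closed in that of T. If C is
  approximated by classes of Cauchy sequences in S, a representative \<open>\<tau>\<close> of C is approximated, at
  suitable late indices \<open>k n\<close>, by single points \<open>s n\<close> of S with errors tending to 0. Then s is a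
  Cauchy sequence in S equivalent to \<open>\<tau>\<close>.\<close>

lemma completion_closed_in_larger:
  assumes C: "C \<in> completion_points (submetric m T)" and ST: "S \<subseteq> T"
    and approx: "\<And>\<epsilon>. 0 < \<epsilon> \<Longrightarrow> \<exists>C'\<in>completion_points (submetric m T). \<exists>D'\<in>completion_points (submetric m S).
       D' \<subseteq> C' \<and> completion_dist (submetric m T) C C' < \<epsilon>"
  obtains D where "D \<in> completion_points (submetric m S)" "D \<subseteq> C"
proof -
  obtain \<tau> where \<tau>: "\<tau> \<in> C" using completion_point_SOME[OF C] by (rule that)
  note \<tau>C = completion_point_rep[OF C \<tau>]
  have \<tau>m: "\<tau> n \<in> mspace m" for n using Cauchy_seqs_in[OF \<tau>C(1)] by simp
  have \<tau>_Cauchy: "\<forall>\<epsilon>>0. \<exists>N. \<forall>n n'. N \<le> n \<longrightarrow> N \<le> n' \<longrightarrow> mdist m (\<tau> n) (\<tau> n') < \<epsilon>"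
    using \<tau>C(1) by (simp add: Cauchy_seqs_iff)
  have "\<exists>sk. fst sk \<in> S \<inter> mspace m \<and> n \<le> snd sk \<and> mdist m (\<tau> (snd sk)) (fst sk) < inverse (real (Suc n))" for n
  proof -
    have pos: "0 < inverse (real (Suc n))" by simp
    obtain C' D' where C': "C' \<in> completion_points (submetric m T)"
      and D': "D' \<in> completion_points (submetric m S)" "D' \<subseteq> C'"
      and lt: "completion_dist (submetric m T) C C' < inverse (real (Suc n))"
      using approx[OF pos] by blast
    obtain \<sigma> where \<sigma>: "\<sigma> \<in> D'" using completion_point_SOME[OF D'(1)] by (rule that)
    then have "(\<lambda>k. mdist m (\<tau> k) (\<sigma> k)) \<longlonglongrightarrow> completion_dist (submetric m T) C C'"
      using completion_dist_tendsto[OF C C' \<tau>, of \<sigma>] D'(2) by auto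
    then have "\<forall>\<^sub>F k in sequentially. mdist m (\<tau> k) (\<sigma> k) < inverse (real (Suc n))"
      using lt by (rule order_tendstoD(2))
    then obtain N where "\<And>k. N \<le> k \<Longrightarrow> mdist m (\<tau> k) (\<sigma> k) < inverse (real (Suc n))"
      unfolding eventually_sequentially by blast
    then have "mdist m (\<tau> (max n N)) (\<sigma> (max n N)) < inverse (real (Suc n))" by simp
    moreover have "\<sigma> k \<in> S \<inter> mspace m" for k
      using Cauchy_seqs_in[OF completion_point_rep(1)[OF D'(1) \<sigma>]] by simp
    ultimately show ?thesis by (intro exI[of _ "(\<sigma> (max n N), max n N)"]) simp
  qed
  then have "\<forall>n. \<exists>sk. fst sk \<in> S \<inter> mspace m \<and> n \<le> snd sk \<and>
      mdist m (\<tau> (snd sk)) (fst sk) < inverse (real (Suc n))" ..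
  then obtain sk where sk: "\<forall>n. fst (sk n) \<in> S \<inter> mspace m \<and> n \<le> snd (sk n) \<and>
      mdist m (\<tau> (snd (sk n))) (fst (sk n)) < inverse (real (Suc n))"
    by (rule choice[THEN exE])
  define s where "s = fst \<circ> sk"
  define k where "k = snd \<circ> sk"
  have s: "s n \<in> S" "s n \<in> mspace m" and k: "n \<le> k n"
    and sk': "mdist m (\<tau> (k n)) (s n) < inverse (real (Suc n))" for n
    using sk by (auto simp: s_def k_def)
  have lim: "(\<lambda>n. mdist m (\<tau> n) (s n)) \<longlonglongrightarrow> 0"
  proof (rule order_tendstoI)
    fix a :: real assume "a < 0"
    then show "\<forall>\<^sub>F n in sequentially. a < mdist m (\<tau> n) (s n)"
      by (intro always_eventually allI) (rule less_le_trans[OF _ mdist_nonneg])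
  next
    fix a :: real assume a: "0 < a"
    then have a2: "0 < a/2" by simp
    from \<tau>_Cauchy a2 obtain N where N: "\<forall>n n'. N \<le> n \<longrightarrow> N \<le> n' \<longrightarrow> mdist m (\<tau> n) (\<tau> n') < a/2"
      by blast
    have "\<forall>\<^sub>F n in sequentially. inverse (real (Suc n)) < a/2"
      using a2 by (rule order_tendstoD(2)[OF LIMSEQ_inverse_real_of_nat])
    then show "\<forall>\<^sub>F n in sequentially. mdist m (\<tau> n) (s n) < a"
      using eventually_ge_at_top[of N]
    proof eventually_elim
      case (elim n)
      have "mdist m (\<tau> n) (\<tau> (k n)) < a/2" using N elim(2) k[of n] by (meson order_trans)
      moreover have "mdist m (\<tau> n) (s n) \<le> mdist m (\<tau> n) (\<tau> (k n)) + mdist m (\<tau> (k n)) (s n)"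
        by (intro mdist_triangle \<tau>m s)
      ultimately show ?case using sk'[of n] elim(1) by linarith
    qed
  qed
  have sC: "s \<in> Cauchy_seqs m"
    unfolding Cauchy_seqs_iff
  proof (intro conjI allI impI)
    show "range s \<subseteq> mspace m" using s by auto
    fix \<epsilon> :: real assume "0 < \<epsilon>"
    then have e3: "0 < \<epsilon>/3" by simp
    from \<tau>_Cauchy e3 obtain N where N: "\<forall>n n'. N \<le> n \<longrightarrow> N \<le> n' \<longrightarrow> mdist m (\<tau> n) (\<tau> n') < \<epsilon>/3"
      by blast
    obtain N' where N': "\<And>n. N' \<le> n \<Longrightarrow> mdist m (\<tau> n) (s n) < \<epsilon>/3"
      using order_tendstoD(2)[OF lim e3] unfolding eventually_sequentially by blast
    have "mdist m (s n) (s n') < \<epsilon>" if "max N N' \<le> n" "max N N' \<le> n'" for n n'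
    proof -
      have "mdist m (\<tau> n) (\<tau> n') < \<epsilon>/3" using N that by auto
      moreover have "mdist m (\<tau> n) (s n) < \<epsilon>/3" "mdist m (\<tau> n') (s n') < \<epsilon>/3" using N' that by auto
      moreover have "\<bar>mdist m (\<tau> n) (\<tau> n') - mdist m (s n) (s n')\<bar> \<le> mdist m (\<tau> n) (s n) + mdist m (\<tau> n') (s n')"
        by (intro mdist_quadrilateral \<tau>m s)
      ultimately show ?thesis by linarith
    qed
    then show "\<exists>N. \<forall>n n'. N \<le> n \<longrightarrow> N \<le> n' \<longrightarrow> mdist m (s n) (s n') < \<epsilon>" by blast
  qed
  then have sS: "s \<in> Cauchy_seqs (submetric m S)" and sT: "s \<in> Cauchy_seqs (submetric m T)"
    using s ST by (auto simp: Cauchy_seqs_submetric)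
  have "(\<tau>, s) \<in> Cauchy_equiv (submetric m T)"
    using \<tau>C(1) sT lim by (simp add: Cauchy_equiv_def)
  then have "s \<in> C" using \<tau>C(2) by blast
  then have "C = Cauchy_equiv (submetric m T) `` {s}" by (rule completion_point_rep(2)[OF C])
  then have "Cauchy_equiv (submetric m S) `` {s} \<subseteq> C"
    using Cauchy_equiv_submetric_mono[OF ST, of m] by blast
  with Cauchy_class_in_completion(1)[OF sS] show ?thesis by (rule that)
qed

lemma compact_inner_completion_in:
  assumes X: "compact_metric (inner_completion m \<delta>')" and "\<delta>' \<le> \<delta>"
  shows "compactin (mtopology_of (inner_completion m \<delta>')) (inner_completion_in m \<delta>' \<delta>)"
proof (rule compactin_metric_closedI[OF X inner_completion_in_subset])
  define S where "S = inner_region m \<delta>"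
  define T where "T = inner_region m \<delta>'"
  have ST: "S \<subseteq> T" unfolding S_def T_def using assms(2) by (rule inner_region_antimono)
  have mem: "C \<in> inner_completion_in m \<delta>' \<delta> \<longleftrightarrow> C \<in> completion_points (submetric m T) \<and>
      (\<exists>D\<in>completion_points (submetric m S). D \<subseteq> C)" for C
    by (simp add: inner_completion_in_def mspace_inner_completion S_def T_def)
  fix C assume C: "C \<in> mspace (inner_completion m \<delta>')"
    and approx: "\<And>\<epsilon>. 0 < \<epsilon> \<Longrightarrow> \<exists>C'\<in>inner_completion_in m \<delta>' \<delta>. mdist (inner_completion m \<delta>') C C' < \<epsilon>"
  have C': "C \<in> completion_points (submetric m T)" using C by (simp add: mspace_inner_completion T_def)
  have d: "mdist (inner_completion m \<delta>') = completion_dist (submetric m T)"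
    by (simp add: inner_completion_def T_def)
  have "\<exists>C'\<in>completion_points (submetric m T). \<exists>D'\<in>completion_points (submetric m S).
       D' \<subseteq> C' \<and> completion_dist (submetric m T) C C' < \<epsilon>" if \<epsilon>: "0 < \<epsilon>" for \<epsilon>
  proof -
    obtain C' where C': "C' \<in> inner_completion_in m \<delta>' \<delta>" "completion_dist (submetric m T) C C' < \<epsilon>"
      using approx[OF \<epsilon>] unfolding d by auto
    then obtain D' where "D' \<in> completion_points (submetric m S)" "D' \<subseteq> C'" unfolding mem by auto
    then show ?thesis using C' unfolding mem by auto
  qed
  then obtain D where "D \<in> completion_points (submetric m S)" "D \<subseteq> C"
    by (rule completion_closed_in_larger[OF C' ST])
  then show "C \<in> inner_completion_in m \<delta>' \<delta>" unfolding mem using C' by auto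
qed

lemma compact_inner_completion_antimono:
  assumes "compact_metric (inner_completion m \<delta>')" "\<delta>' \<le> \<delta>"
  shows "compact_metric (inner_completion m \<delta>)"
proof -
  obtain \<iota> where \<iota>: "isometric_embedding (inner_completion m \<delta>) (inner_completion m \<delta>') \<iota>"
    "\<iota> ` mspace (inner_completion m \<delta>) = inner_completion_in m \<delta>' \<delta>"
    by (rule inner_completion_embedding[OF assms(2)])
  from compact_inner_completion_in[OF assms] show ?thesis
    unfolding \<iota>(2)[symmetric] compactin_isometric_image_iff[OF \<iota>(1)] .
qed

section \<open>Subsequential limit embeddings and intermediate limits\<close>

lemma hausdorff_converges_cong:
  assumes "\<forall>\<^sub>F j in sequentially. A j = B j"
  shows "hausdorff_converges m A K \<longleftrightarrow> hausdorff_converges m B K"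
  unfolding hausdorff_converges_def using assms
  by (intro tendsto_cong) (auto elim: eventually_mono)

lemma hausdorff_converges_subseq:
  assumes "hausdorff_converges m A K" "strict_mono r"
  shows "hausdorff_converges m (\<lambda>k. A (r k)) K"
  using LIMSEQ_subseq_LIMSEQ[of "\<lambda>j. hausdorff_dist m (A j) K"] assms
  by (simp add: hausdorff_converges_def o_def)

lemma hausdorff_subsequence_of_eventually_subsets:
  fixes Z :: "'a metric"
  assumes Z: "compact_metric Z" and A: "\<forall>\<^sub>F n in sequentially. A n \<subseteq> mspace Z"
  obtains K r where "strict_mono (r::nat\<Rightarrow>nat)" "compactin (mtopology_of Z) K"
    "hausdorff_converges Z (\<lambda>k. A (r k)) K"
proof -
  define A' where "A' n = A n \<inter> mspace Z" for n
  have "A' n \<subseteq> mspace Z" for n by (simp add: A'_def)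
  from compact_metric_hausdorff_subsequence[OF Z this]
  obtain K r where K: "strict_mono (r::nat\<Rightarrow>nat)" "compactin (mtopology_of Z) K"
    "hausdorff_converges Z (\<lambda>k. A' (r k)) K" .
  have "\<forall>\<^sub>F n in sequentially. A' n = A n"
    using A by (rule eventually_mono) (auto simp: A'_def)
  then have ev: "\<forall>\<^sub>F k in sequentially. A' (r k) = A (r k)" using K(1) by (rule eventually_subseq[rotated])
  from K(1,2) K(3)[unfolded hausdorff_converges_cong[OF ev]] show ?thesis by (rule that)
qed

text \<open>The limit \<open>K\<close> of a subsequence of the copies at depth \<open>\<delta>\<close> lies in the image of \<open>\<psi>\<close>, so the
  isometry of Y onto \<open>K\<close> can be pulled back through \<open>\<psi>\<close>.\<close>

lemma exists_subsequential_limit_embedding: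
  fixes m :: "nat \<Rightarrow> 'a metric" and Y Y' :: "'b metric"
  assumes le: "\<delta>' \<le> \<delta>" and Y': "compact_metric Y'" and Y: "compact_metric Y"
    and GH': "GH_converges (\<lambda>j. inner_completion (m j) \<delta>') Y'"
    and GH: "GH_converges (\<lambda>j. inner_completion (m j) \<delta>) Y"
  obtains f where "subsequential_limit_embedding m \<delta>' \<delta> Y' Y f"
proof -
  define X where "X j = inner_completion (m j) \<delta>'" for j
  obtain Z :: "(nat \<Rightarrow> real) metric" and \<phi> \<psi> where Z: "compact_metric Z"
    and \<phi>: "\<And>j. compact_metric (X j) \<Longrightarrow> isometric_embedding (X j) Z (\<phi> j)"
    and \<psi>: "isometric_embedding Y' Z \<psi>"
    and conv: "hausdorff_converges Z (\<lambda>j. \<phi> j ` mspace (X j)) (\<psi> ` mspace Y')"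
    using common_compact_space[OF Y' GH'] unfolding X_def by blast
  define A where "A j = inner_completion_in (m j) \<delta>' \<delta>" for j
  have AX: "A j \<subseteq> mspace (X j)" for j unfolding A_def X_def by (rule inner_completion_in_subset)
  have X: "\<forall>\<^sub>F j in sequentially. compact_metric (X j)"
    using GH' unfolding GH_converges_def X_def by blast
  have sub: "\<forall>\<^sub>F j in sequentially. \<phi> j ` A j \<subseteq> \<phi> j ` mspace (X j) \<and> \<phi> j ` mspace (X j) \<subseteq> mspace Z"
    using X
  proof (rule eventually_mono)
    fix j assume "compact_metric (X j)"
    from isometric_embeddingD(1)[OF \<phi>[OF this]] AX
    show "\<phi> j ` A j \<subseteq> \<phi> j ` mspace (X j) \<and> \<phi> j ` mspace (X j) \<subseteq> mspace Z" by blast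
  qed
  have "\<forall>\<^sub>F j in sequentially. \<phi> j ` A j \<subseteq> mspace Z"
    using sub by (rule eventually_mono) blast
  from hausdorff_subsequence_of_eventually_subsets[OF Z this]
  obtain K r where r: "strict_mono (r::nat\<Rightarrow>nat)" and K: "compactin (mtopology_of Z) K"
    and KA: "hausdorff_converges Z (\<lambda>k. \<phi> (r k) ` A (r k)) K" .
  have \<psi>Y': "compactin (mtopology_of Z) (\<psi> ` mspace Y')"
    unfolding compactin_isometric_image_iff[OF \<psi>] by (rule Y')
  have K\<psi>: "K \<subseteq> \<psi> ` mspace Y'"
  proof (rule hausdorff_limit_mono[OF KA hausdorff_converges_subseq[OF conv r] _ _ \<psi>Y'])
    show "\<forall>\<^sub>F k in sequentially. \<phi> (r k) ` A (r k) \<subseteq> \<phi> (r k) ` mspace (X (r k)) \<and>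
        \<phi> (r k) ` mspace (X (r k)) \<subseteq> mspace Z"
      using r sub by (rule eventually_subseq)
    show "K \<subseteq> mspace Z" using compactin_subset_topspace[OF K] by simp
  qed
  have "\<forall>j. \<exists>\<iota>. isometric_embedding (inner_completion (m j) \<delta>) (X j) \<iota> \<and>
      \<iota> ` mspace (inner_completion (m j) \<delta>) = A j"
    unfolding A_def X_def by (rule allI, rule inner_completion_embedding[OF le]) blast
  then obtain \<iota> where \<iota>: "\<forall>j. isometric_embedding (inner_completion (m j) \<delta>) (X j) (\<iota> j) \<and>
      \<iota> j ` mspace (inner_completion (m j) \<delta>) = A j"
    by (rule choice[THEN exE])
  obtain g where g: "isometric_embedding Y Z g" "g ` mspace Y = K"
  proof (rule GH_limit_isometric_hausdorff_limit[OF Y K])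
    have "(\<lambda>j. GH_dist (inner_completion (m j) \<delta>) Y) \<longlonglongrightarrow> 0"
      using GH unfolding GH_converges_def by blast
    from LIMSEQ_subseq_LIMSEQ[OF this r]
    show "(\<lambda>k. GH_dist (inner_completion (m (r k)) \<delta>) Y) \<longlonglongrightarrow> 0" by (simp add: o_def)
    have "\<forall>\<^sub>F k in sequentially. compact_metric (X (r k))" using r X by (rule eventually_subseq)
    then show "\<forall>\<^sub>F k in sequentially. isometric_embedding (inner_completion (m (r k)) \<delta>) Z (\<phi> (r k) \<circ> \<iota> (r k))"
    proof (rule eventually_mono)
      fix k assume "compact_metric (X (r k))"
      with \<iota> \<phi> show "isometric_embedding (inner_completion (m (r k)) \<delta>) Z (\<phi> (r k) \<circ> \<iota> (r k))"
        by (intro isometric_embedding_compose[of _ "X (r k)"]) simp_all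
    qed
    show "hausdorff_converges Z (\<lambda>k. (\<phi> (r k) \<circ> \<iota> (r k)) ` mspace (inner_completion (m (r k)) \<delta>)) K"
      unfolding image_comp[symmetric] using KA \<iota> by simp
  qed
  define f where "f = inv_into (mspace Y') \<psi> \<circ> g"
  have \<psi>f: "\<psi> (f y) = g y" and fY': "f y \<in> mspace Y'" if y: "y \<in> mspace Y" for y
  proof -
    have "g y \<in> \<psi> ` mspace Y'" using g(2) K\<psi> y by blast
    then show "\<psi> (f y) = g y" "f y \<in> mspace Y'"
      by (simp_all add: f_def f_inv_into_f inv_into_into)
  qed
  have f: "isometric_embedding Y Y' f"
    unfolding isometric_embedding_def
  proof (intro conjI ballI funcsetI fY')
    fix x y assume x: "x \<in> mspace Y" and y: "y \<in> mspace Y"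
    have "mdist Y' (f x) (f y) = mdist Z (\<psi> (f x)) (\<psi> (f y))"
      using isometric_embeddingD(2)[OF \<psi> fY'[OF x] fY'[OF y]] by simp
    also have "\<dots> = mdist Y x y"
      using isometric_embeddingD(2)[OF g(1) x y] \<psi>f x y by simp
    finally show "mdist Y' (f x) (f y) = mdist Y x y" .
  qed
  have fim: "f ` mspace Y = {y \<in> mspace Y'. \<psi> y \<in> K}"
  proof (intro set_eqI iffI)
    fix z assume "z \<in> f ` mspace Y"
    then show "z \<in> {y \<in> mspace Y'. \<psi> y \<in> K}" using \<psi>f fY' g(2) by auto
  next
    fix z assume "z \<in> {y \<in> mspace Y'. \<psi> y \<in> K}"
    then have z: "z \<in> mspace Y'" "\<psi> z \<in> K" by auto
    then obtain y where y: "y \<in> mspace Y" "\<psi> z = g y" using g(2) by auto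
    have "f y = z"
      using inj_onD[OF isometric_embedding_inj_on[OF \<psi>] _ fY'[OF y(1)] z(1)] \<psi>f[OF y(1)] y(2) by simp
    then show "z \<in> f ` mspace Y" using y(1) by blast
  qed
  show ?thesis
  proof (rule that)
    show "subsequential_limit_embedding m \<delta>' \<delta> Y' Y f"
      unfolding subsequential_limit_embedding_def
    proof (intro conjI exI f)
      show "compact_metric Z" by (rule Z)
      show "\<forall>j. compact_metric (inner_completion (m j) \<delta>') \<longrightarrow>
          isometric_embedding (inner_completion (m j) \<delta>') Z (\<phi> j)" using \<phi> unfolding X_def by blast
      show "isometric_embedding Y' Z \<psi>" by (rule \<psi>)
      show "hausdorff_converges Z (\<lambda>j. \<phi> j ` mspace (inner_completion (m j) \<delta>')) (\<psi> ` mspace Y')"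
        using conv unfolding X_def .
      show "strict_mono r" by (rule r)
      show "compactin (mtopology_of Z) K" by (rule K)
      show "hausdorff_converges Z (\<lambda>k. \<phi> (r k) ` inner_completion_in (m (r k)) \<delta>' \<delta>) K"
        using KA unfolding A_def .
      show "f ` mspace Y = {y \<in> mspace Y'. \<psi> y \<in> K}" by (rule fim)
    qed
  qed
qed

text \<open>For equal depths the construction above could return any self-isometry of Y. The identity
  has the required form too, with the whole sequence and \<open>K = \<psi> ` Y\<close>.\<close>

lemma subsequential_limit_embedding_identity:
  assumes Y: "compact_metric Y" and GH: "GH_converges (\<lambda>j. inner_completion (m j) \<delta>) Y"
  shows "subsequential_limit_embedding m \<delta> \<delta> Y Y (\<lambda>y. y)"
proof -
  obtain Z :: "(nat \<Rightarrow> real) metric" and \<phi> \<psi> where Z: "compact_metric Z"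
    and \<phi>: "\<And>j. compact_metric (inner_completion (m j) \<delta>) \<Longrightarrow> isometric_embedding (inner_completion (m j) \<delta>) Z (\<phi> j)"
    and \<psi>: "isometric_embedding Y Z \<psi>"
    and conv: "hausdorff_converges Z (\<lambda>j. \<phi> j ` mspace (inner_completion (m j) \<delta>)) (\<psi> ` mspace Y)"
    using common_compact_space[OF Y GH] by blast
  show ?thesis
    unfolding subsequential_limit_embedding_def
  proof (intro conjI exI)
    show "isometric_embedding Y Y (\<lambda>y. y)" by (simp add: isometric_embedding_def)
    show "compact_metric Z" by (rule Z)
    show "\<forall>j. compact_metric (inner_completion (m j) \<delta>) \<longrightarrow>
        isometric_embedding (inner_completion (m j) \<delta>) Z (\<phi> j)" using \<phi> by blast
    show "isometric_embedding Y Z \<psi>" by (rule \<psi>)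
    show "hausdorff_converges Z (\<lambda>j. \<phi> j ` mspace (inner_completion (m j) \<delta>)) (\<psi> ` mspace Y)" by (rule conv)
    show "strict_mono (id :: nat \<Rightarrow> nat)" by (rule strict_mono_id)
    show "compactin (mtopology_of Z) (\<psi> ` mspace Y)"
      unfolding compactin_isometric_image_iff[OF \<psi>] by (rule Y)
    show "hausdorff_converges Z (\<lambda>k. \<phi> (id k) ` inner_completion_in (m (id k)) \<delta> \<delta>) (\<psi> ` mspace Y)"
      using conv by (simp add: inner_completion_in_self)
    show "(\<lambda>y. y) ` mspace Y = {y \<in> mspace Y. \<psi> y \<in> \<psi> ` mspace Y}" by auto
  qed
qed

text \<open>The ambient space Z and the subsequence r are those that witness the given embedding f, so that
  the selection at depth d refines the one that produced f.\<close>

lemma exists_intermediate_limit: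
  fixes m :: "nat \<Rightarrow> 'a metric" and Y Y' :: "'b metric"
  assumes d: "\<delta>' \<le> d" "d \<le> \<delta>" and Y': "compact_metric Y'"
    and X: "\<forall>\<^sub>F j in sequentially. compact_metric (inner_completion (m j) \<delta>')"
    and f: "subsequential_limit_embedding m \<delta>' \<delta> Y' Y f"
  obtains S where "intermediate_limit m d Y' Y f S"
proof -
  obtain Z :: "(nat \<Rightarrow> real) metric" and \<phi> \<psi> r K where Z: "compact_metric Z"
    and \<phi>: "\<forall>j. compact_metric (inner_completion (m j) \<delta>') \<longrightarrow>
             isometric_embedding (inner_completion (m j) \<delta>') Z (\<phi> j)"
    and \<psi>: "isometric_embedding Y' Z \<psi>"
    and conv: "hausdorff_converges Z (\<lambda>j. \<phi> j ` mspace (inner_completion (m j) \<delta>')) (\<psi> ` mspace Y')"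
    and r: "strict_mono r" and K: "compactin (mtopology_of Z) K"
    and KA: "hausdorff_converges Z (\<lambda>k. \<phi> (r k) ` inner_completion_in (m (r k)) \<delta>' \<delta>) K"
    and fim: "f ` mspace Y = {y \<in> mspace Y'. \<psi> y \<in> K}"
    using f unfolding subsequential_limit_embedding_def by auto
  have sub: "\<forall>\<^sub>F j in sequentially.
      \<phi> j ` inner_completion_in (m j) \<delta>' \<delta> \<subseteq> \<phi> j ` inner_completion_in (m j) \<delta>' d \<and>
      \<phi> j ` inner_completion_in (m j) \<delta>' d \<subseteq> \<phi> j ` mspace (inner_completion (m j) \<delta>') \<and>
      \<phi> j ` inner_completion_in (m j) \<delta>' d \<subseteq> mspace Z \<and>
      \<phi> j ` mspace (inner_completion (m j) \<delta>') \<subseteq> mspace Z"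
    using X
  proof (rule eventually_mono)
    fix j assume "compact_metric (inner_completion (m j) \<delta>')"
    then have "isometric_embedding (inner_completion (m j) \<delta>') Z (\<phi> j)" using \<phi> by simp
    then have "\<phi> j ` mspace (inner_completion (m j) \<delta>') \<subseteq> mspace Z"
      by (auto dest: isometric_embeddingD(1))
    with inner_completion_in_antimono[OF d, of "m j"] inner_completion_in_subset[of "m j" \<delta>' d]
    show "\<phi> j ` inner_completion_in (m j) \<delta>' \<delta> \<subseteq> \<phi> j ` inner_completion_in (m j) \<delta>' d \<and>
      \<phi> j ` inner_completion_in (m j) \<delta>' d \<subseteq> \<phi> j ` mspace (inner_completion (m j) \<delta>') \<and>
      \<phi> j ` inner_completion_in (m j) \<delta>' d \<subseteq> mspace Z \<and>
      \<phi> j ` mspace (inner_completion (m j) \<delta>') \<subseteq> mspace Z" by blast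
  qed
  note sub_r = eventually_subseq[OF r sub]
  have "\<forall>\<^sub>F k in sequentially. \<phi> (r k) ` inner_completion_in (m (r k)) \<delta>' d \<subseteq> mspace Z"
    using sub_r by (rule eventually_mono) blast
  from hausdorff_subsequence_of_eventually_subsets[OF Z this]
  obtain L t where t: "strict_mono (t::nat\<Rightarrow>nat)" and L: "compactin (mtopology_of Z) L"
    and LB: "hausdorff_converges Z (\<lambda>k. \<phi> (r (t k)) ` inner_completion_in (m (r (t k))) \<delta>' d) L" .
  define q where "q = r \<circ> t"
  have q: "strict_mono q" unfolding q_def using r t by (rule strict_mono_o)
  have LB': "hausdorff_converges Z (\<lambda>k. \<phi> (q k) ` inner_completion_in (m (q k)) \<delta>' d) L"
    using LB by (simp add: q_def)
  have KA': "hausdorff_converges Z (\<lambda>k. \<phi> (q k) ` inner_completion_in (m (q k)) \<delta>' \<delta>) K"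
    using hausdorff_converges_subseq[OF KA t] by (simp add: q_def)
  note sub_q = eventually_subseq[OF q sub]
  have \<psi>Y': "compactin (mtopology_of Z) (\<psi> ` mspace Y')"
    unfolding compactin_isometric_image_iff[OF \<psi>] by (rule Y')
  have KL: "K \<subseteq> L"
    by (rule hausdorff_limit_mono[OF KA' LB' _ _ L])
      (use sub_q compactin_subset_topspace[OF K] in \<open>auto elim: eventually_mono\<close>)
  have L\<psi>: "L \<subseteq> \<psi> ` mspace Y'"
    by (rule hausdorff_limit_mono[OF LB' hausdorff_converges_subseq[OF conv q] _ _ \<psi>Y'])
      (use sub_q compactin_subset_topspace[OF L] in \<open>auto elim: eventually_mono\<close>)
  define S where "S = {y \<in> mspace Y'. \<psi> y \<in> L}"
  define Y'' where "Y'' = submetric Y' S"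
  have mY'': "mspace Y'' = S" by (auto simp: Y''_def S_def)
  have \<psi>'': "isometric_embedding Y'' Z \<psi>"
    using \<psi> by (auto simp: isometric_embedding_def Y''_def)
  have \<psi>S: "\<psi> ` mspace Y'' = L" using L\<psi> by (auto simp: mY'' S_def)
  have "GH_converges (\<lambda>k. inner_completion (m (q k)) d) Y''"
    unfolding GH_converges_def
  proof
    have Xq: "\<forall>\<^sub>F k in sequentially. compact_metric (inner_completion (m (q k)) \<delta>')"
      using q X by (rule eventually_subseq)
    then show "\<forall>\<^sub>F k in sequentially. compact_metric (inner_completion (m (q k)) d)"
      by (rule eventually_mono) (rule compact_inner_completion_antimono[OF _ d(1)])
    have le: "\<forall>\<^sub>F k in sequentially. GH_dist (inner_completion (m (q k)) d) Y'' \<le>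
        hausdorff_dist Z (\<phi> (q k) ` inner_completion_in (m (q k)) \<delta>' d) L"
      using Xq
    proof (rule eventually_mono)
      fix k assume "compact_metric (inner_completion (m (q k)) \<delta>')"
      then have \<phi>k: "isometric_embedding (inner_completion (m (q k)) \<delta>') Z (\<phi> (q k))" using \<phi> by simp
      obtain \<iota> where \<iota>: "isometric_embedding (inner_completion (m (q k)) d) (inner_completion (m (q k)) \<delta>') \<iota>"
        "\<iota> ` mspace (inner_completion (m (q k)) d) = inner_completion_in (m (q k)) \<delta>' d"
        by (rule inner_completion_embedding[OF d(1)])
      from GH_dist_le_hausdorff_dist[OF isometric_embedding_compose[OF \<iota>(1) \<phi>k] \<psi>'']
      show "GH_dist (inner_completion (m (q k)) d) Y'' \<le>
          hausdorff_dist Z (\<phi> (q k) ` inner_completion_in (m (q k)) \<delta>' d) L"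
        unfolding image_comp[symmetric] \<iota>(2) \<psi>S .
    qed
    show "(\<lambda>k. GH_dist (inner_completion (m (q k)) d) Y'') \<longlonglongrightarrow> 0"
      by (rule tendsto_sandwich[OF _ le tendsto_const LB'[unfolded hausdorff_converges_def]]) simp
  qed
  moreover have "compact_metric Y''"
    using L unfolding \<psi>S[symmetric] compactin_isometric_image_iff[OF \<psi>''] .
  moreover have "f ` mspace Y \<subseteq> S" "S \<subseteq> mspace Y'" using fim KL by (auto simp: S_def)
  ultimately have "intermediate_limit m d Y' Y f S"
    unfolding intermediate_limit_def Y''_def[symmetric] using q by blast
  then show ?thesis by (rule that)
qed

theorem theorem6p1:
  fixes \<delta> :: "nat \<Rightarrow> real"
    and M :: "nat \<Rightarrow> 'a riemannian"
    and Y :: "real \<Rightarrow> 'b metric"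
  assumes "\<forall>i. 0 < \<delta> i"
    and "decseq \<delta>"
    and "\<delta> \<longlonglongrightarrow> 0"
    and "\<forall>j. open_riemannian_manifold (M j)"
    and "\<forall>i. compact_metric (Y (\<delta> i))"
    and "\<forall>i. GH_converges (\<lambda>j. inner_completion (length_metric (M j)) (\<delta> i)) (Y (\<delta> i))"
  shows "\<exists>\<phi> :: nat \<Rightarrow> 'b \<Rightarrow> 'b.
    (\<forall>i. subsequential_limit_embedding (\<lambda>j. length_metric (M j)) (\<delta> (Suc i)) (\<delta> i)
           (Y (\<delta> (Suc i))) (Y (\<delta> i)) (\<phi> i)) \<and>
    (\<forall>i. \<delta> (Suc i) = \<delta> i \<longrightarrow> (\<forall>y \<in> mspace (Y (\<delta> i)). \<phi> i y = y)) \<and>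
    (\<forall>d i. 0 < d \<and> d \<le> \<delta> 0 \<and> \<delta> (Suc i) \<le> d \<and> d \<le> \<delta> i \<longrightarrow>
       (\<exists>S. intermediate_limit (\<lambda>j. length_metric (M j)) d
              (Y (\<delta> (Suc i))) (Y (\<delta> i)) (\<phi> i) S) \<and>
       (\<delta> (Suc i) < d \<and> d < \<delta> i \<longrightarrow>
         (\<forall>S. intermediate_limit (\<lambda>j. length_metric (M j)) d
                (Y (\<delta> (Suc i))) (Y (\<delta> i)) (\<phi> i) S \<longrightarrow>
              isometric_embedding (Y (\<delta> i)) (submetric (Y (\<delta> (Suc i))) S) (\<phi> i) \<and>
              isometric_embedding (submetric (Y (\<delta> (Suc i))) S) (Y (\<delta> (Suc i))) (\<lambda>y. y))))"
proof -
  define m where "m = (\<lambda>j. length_metric (M j))"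
  note Y = assms(5)[rule_format]
  have GH: "GH_converges (\<lambda>j. inner_completion (m j) (\<delta> i)) (Y (\<delta> i))" for i
    using assms(6) by (simp add: m_def)
  have "\<exists>f. subsequential_limit_embedding m (\<delta> (Suc i)) (\<delta> i) (Y (\<delta> (Suc i))) (Y (\<delta> i)) f \<and>
      (\<delta> (Suc i) = \<delta> i \<longrightarrow> f = (\<lambda>y. y))" for i
  proof (cases "\<delta> (Suc i) = \<delta> i")
    case True
    then show ?thesis using subsequential_limit_embedding_identity[OF Y GH, of i] by auto
  next
    case False
    have "\<delta> (Suc i) \<le> \<delta> i" using assms(2) by (simp add: decseq_SucD)
    from exists_subsequential_limit_embedding[OF this Y Y GH GH] False show ?thesis by blast
  qed
  then have "\<forall>i. \<exists>f. subsequential_limit_embedding m (\<delta> (Suc i)) (\<delta> i) (Y (\<delta> (Suc i))) (Y (\<delta> i)) f \<and>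
      (\<delta> (Suc i) = \<delta> i \<longrightarrow> f = (\<lambda>y. y))" ..
  then obtain \<phi> where \<phi>: "\<forall>i. subsequential_limit_embedding m (\<delta> (Suc i)) (\<delta> i)
      (Y (\<delta> (Suc i))) (Y (\<delta> i)) (\<phi> i) \<and> (\<delta> (Suc i) = \<delta> i \<longrightarrow> \<phi> i = (\<lambda>y. y))"
    by (rule choice[THEN exE])
  have lim: "\<exists>S. intermediate_limit m d (Y (\<delta> (Suc i))) (Y (\<delta> i)) (\<phi> i) S"
    if "\<delta> (Suc i) \<le> d" "d \<le> \<delta> i" for d i
  proof -
    have "\<forall>\<^sub>F j in sequentially. compact_metric (inner_completion (m j) (\<delta> (Suc i)))"
      using GH[of "Suc i"] unfolding GH_converges_def by blast
    from exists_intermediate_limit[OF that Y this \<phi>[rule_format, THEN conjunct1]] show ?thesis by blast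
  qed
  have emb: "isometric_embedding (Y (\<delta> i)) (submetric (Y (\<delta> (Suc i))) S) (\<phi> i)"
      "isometric_embedding (submetric (Y (\<delta> (Suc i))) S) (Y (\<delta> (Suc i))) (\<lambda>y. y)"
    if S: "intermediate_limit m d (Y (\<delta> (Suc i))) (Y (\<delta> i)) (\<phi> i) S" for d i S
  proof -
    have "isometric_embedding (Y (\<delta> i)) (Y (\<delta> (Suc i))) (\<phi> i)"
      using \<phi> by (simp add: subsequential_limit_embedding_def)
    moreover have "\<phi> i ` mspace (Y (\<delta> i)) \<subseteq> S"
      using S by (simp add: intermediate_limit_def)
    ultimately show "isometric_embedding (Y (\<delta> i)) (submetric (Y (\<delta> (Suc i))) S) (\<phi> i)"
      by (auto simp: isometric_embedding_def)
    show "isometric_embedding (submetric (Y (\<delta> (Suc i))) S) (Y (\<delta> (Suc i))) (\<lambda>y. y)"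
      by (simp add: isometric_embedding_def)
  qed
  show ?thesis
    unfolding m_def[symmetric]
    using \<phi> lim emb by (intro exI[of _ \<phi>]) auto
qed

end
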